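(* The space $\mathrm{DQSym}$ of diagonally quasi-symmetric series, with the multiplication, unit, comultiplication $\Delta$, counit $\epsilon$ and bidegree described in the context, is a bigraded Hopf algebra over $\mathbb{Q}$, and the map $\pi\colon \mathrm{DQSym}\to\mathrm{QSym}$ induced by setting $y_i=x_i$ for all $i$ is a morphism of graded Hopf algebras, where $\mathrm{DQSym}$ is graded by total degree.
   Context: A bicomposition of length $\ell(\mathfrak a)=k$ is a sequence $\mathfrak a=(\alpha_1,\dots,\alpha_k)$ of nonzero vectors $\alpha_m=(a_m,b_m)\in\mathbb{N}\times\mathbb{N}$ (where $0\in\mathbb N$); the empty bicomposition, of length $0$, is also denoted $0$. We also write $\mathfrak a=(\mathbf a,\mathbf b)$ with $\mathbf a=(a_1,\dots,a_k)$, $\mathbf b=(b_1,\dots,b_k)$. The bidegree of $\mathfrak a$ is $d(\mathfrak a)=(a_1+\dots+a_k,\;b_1+\dots+b_k)$. The concatenation of $\mathfrak a=(\alpha_1,\dots,\alpha_k)$ and $\mathfrak b=(\beta_1,\dots,\beta_\ell)$ is $\mathfrak a\cdot\mathfrak b=(\alpha_1,\dots,\alpha_k,\beta_1,\dots,\beta_\ell)$. In two infinite sets of commuting variables $x_1,x_2,\dots$ and $y_1,y_2,\dots$, for each bicomposition $\mathfrak a$ define the formal series $$M_{\mathfrak a}=\sum_{i_1<i_2<\dots<i_k} x_{i_1}^{a_1}y_{i_1}^{b_1}x_{i_2}^{a_2}y_{i_2}^{b_2}\cdots x_{i_k}^{a_k}y_{i_k}^{b_k},\qquad k=\ell(\mathfrak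 a),$$ with $M_0=1$ for the empty bicomposition. $\mathrm{DQSym}$ is the $\mathbb{Q}$-vector space with basis $\{M_{\mathfrak a}\}$, $\mathfrak a$ running over all bicompositions. Its multiplication is the usual multiplication of formal series (under which it is closed), with unit $M_0=1$. Its comultiplication and counit are the linear maps given by $$\Delta(M_{\mathfrak a})=\sum_{\mathfrak a_1\cdot\mathfrak a_2=\mathfrak a}M_{\mathfrak a_1}\otimes M_{\mathfrak a_2},\qquad \epsilon(M_{\mathfrak a})=\begin{cases}1&\text{if }\mathfrak a=0,\\0&\text{otherwise},\end{cases}$$ where the sum is over all factorizations of $\mathfrak a$ as a concatenation, including those with an empty factor. The bidegree of $M_{\mathfrak a}$ is $d(\mathfrak a)$. The grading by total degree has degree-$n$ component $\bigoplus_{d_1+d_2=n}\mathrm{DQSym}^{(d_1,d_2)}$, where $\mathrm{DQSym}^{(d_1,d_2)}$ is the span of the $M_{\mathfrak a}$ with $d(\mathfrak a)=(d_1,d_2)$. $\mathrm{QSym}$ is the usual graded Hopf algebra of quasi-symmetric functions in $x_1,x_2,\dots$ over $\mathbb{Q}$, with monomial basis $M_{\mathbf c}=\sum_{i_1<\dots<i_k}x_{i_1}^{c_1}\cdots x_{i_k}^{c_k}$ indexed by compositions $\mathbf c=(c_1,\dots,c_k)$ of positive integers, multiplication of formal series, and comultiplication given by deconcatenation of compositions. The map $\pi$ satisfies $\pi(M_{(\mathbf a,\mathbf b)})=M_{\mathbf a+\mathbf b}$. *)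

theory Defs
  imports Complex_Main "HOL-Library.Poly_Mapping" "HOL-Library.Product_Plus"
begin

section \<open>Vector spaces over the rationals\<close>

class rat_vector = ab_group_add +
  fixes scaleQ :: "rat \<Rightarrow> 'a \<Rightarrow> 'a" (infixr \<open>*\<^sub>Q\<close> 75)
  assumes scaleQ_add_right: "a *\<^sub>Q (x + y) = a *\<^sub>Q x + a *\<^sub>Q y"
    and scaleQ_add_left: "(a + b) *\<^sub>Q x = a *\<^sub>Q x + b *\<^sub>Q x"
    and scaleQ_scaleQ: "a *\<^sub>Q b *\<^sub>Q x = (a * b) *\<^sub>Q x"
    and scaleQ_one: "1 *\<^sub>Q x = x"

global_interpretation Q: vector_space "scaleQ :: rat \<Rightarrow> 'a \<Rightarrow> 'a::rat_vector"
  by unfold_locales (fact scaleQ_add_right scaleQ_add_left scaleQ_scaleQ scaleQ_one)+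

global_interpretation QP: vector_space_pair
  "scaleQ :: rat \<Rightarrow> 'a \<Rightarrow> 'a::rat_vector" "scaleQ :: rat \<Rightarrow> 'b \<Rightarrow> 'b::rat_vector"
  by unfold_locales

abbreviation qlinear :: "('a::rat_vector \<Rightarrow> 'b::rat_vector) \<Rightarrow> bool"
  where "qlinear \<equiv> Vector_Spaces.linear scaleQ scaleQ"

definition qbilinear :: "('a::rat_vector \<Rightarrow> 'b::rat_vector \<Rightarrow> 'c::rat_vector) \<Rightarrow> bool"
  where "qbilinear \<beta> \<longleftrightarrow> (\<forall>a. qlinear (\<beta> a)) \<and> (\<forall>b. qlinear (\<lambda>a. \<beta> a b))"

lemma qlinear_iff:
  "qlinear f \<longleftrightarrow> (\<forall>x y. f (x + y) = f x + f y) \<and> (\<forall>c x. f (c *\<^sub>Q x) = c *\<^sub>Q f x)"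
  by (simp add: Vector_Spaces.linear_iff Q.vector_space_axioms)

lemma qlinearI:
  "(\<And>x y. f (x + y) = f x + f y) \<Longrightarrow> (\<And>c x. f (c *\<^sub>Q x) = c *\<^sub>Q f x) \<Longrightarrow> qlinear f"
  by (simp add: qlinear_iff)

lemma qlinear_add: "qlinear f \<Longrightarrow> f (x + y) = f x + f y"
  by (simp add: qlinear_iff)

lemma qlinear_scale: "qlinear f \<Longrightarrow> f (c *\<^sub>Q x) = c *\<^sub>Q f x"
  by (simp add: qlinear_iff)

lemma qlinear_diff: "qlinear f \<Longrightarrow> f (x - y) = f x - f y"
  by (metis add_diff_cancel_right' diff_add_cancel qlinear_add)

lemma qlinear_zero: "qlinear f \<Longrightarrow> f 0 = 0"
  by (metis add_cancel_left_left qlinear_add)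

lemma qlinear_sum: "qlinear f \<Longrightarrow> f (sum g A) = (\<Sum>x\<in>A. f (g x))"
  by (induction A rule: infinite_finite_induct) (auto simp: qlinear_add qlinear_zero)

lemma qlinear_eq_on_span:
  assumes "qlinear f" "qlinear g" "\<And>x. x \<in> S \<Longrightarrow> f x = g x" "x \<in> Q.span S"
  shows "f x = g x"
  using assms(4)
  by (induction rule: Q.span_induct_alt)
     (auto simp: assms qlinear_zero qlinear_add qlinear_scale)

instantiation rat :: rat_vector
begin
definition scaleQ_rat :: "rat \<Rightarrow> rat \<Rightarrow> rat" where "scaleQ_rat c x = c * x"
instance by standard (auto simp: scaleQ_rat_def algebra_simps)
end

instantiation poly_mapping :: (type, rat_vector) rat_vector
begin
lift_definition scaleQ_poly_mapping :: "rat \<Rightarrow> ('a \<Rightarrow>\<^sub>0 'b) \<Rightarrow> 'a \<Rightarrow>\<^sub>0 'b"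
  is "\<lambda>c f k. c *\<^sub>Q f k"
  by (rule finite_subset[rotated], assumption) auto
instance
  by standard (transfer; simp add: fun_eq_iff scaleQ_add_right scaleQ_add_left scaleQ_scaleQ scaleQ_one)+
end


section \<open>Tensor products\<close>

text \<open>
  The tensor product is the free vector space on \<open>'a \<times> 'b\<close> modulo the bilinearity relations.
\<close>

definition tensor_relations :: "('a::rat_vector \<times> 'b::rat_vector \<Rightarrow>\<^sub>0 rat) set" where
  "tensor_relations = Q.span (
     {Poly_Mapping.single (a + a', b) 1 - Poly_Mapping.single (a, b) 1
        - Poly_Mapping.single (a', b) 1 | a a' b. True} \<union>
     {Poly_Mapping.single (a, b + b') 1 - Poly_Mapping.single (a, b) 1
        - Poly_Mapping.single (a, b') 1 | a b b'. True} \<union>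
     {Poly_Mapping.single (c *\<^sub>Q a, b) 1 - c *\<^sub>Q Poly_Mapping.single (a, b) 1 | c a b. True} \<union>
     {Poly_Mapping.single (a, c *\<^sub>Q b) 1 - c *\<^sub>Q Poly_Mapping.single (a, b) 1 | c a b. True})"

definition tensor_eq ::
    "('a::rat_vector \<times> 'b::rat_vector \<Rightarrow>\<^sub>0 rat) \<Rightarrow> ('a \<times> 'b \<Rightarrow>\<^sub>0 rat) \<Rightarrow> bool" where
  "tensor_eq s t \<longleftrightarrow> s - t \<in> tensor_relations"

lemma tensor_relations_subspace: "Q.subspace tensor_relations"
  unfolding tensor_relations_def by (rule Q.subspace_span)

lemma tensor_eq_equivp: "equivp tensor_eq"
proof (rule equivpI)
  show "reflp tensor_eq"
    by (simp add: reflp_def tensor_eq_def Q.subspace_0[OF tensor_relations_subspace])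
  show "symp tensor_eq"
  proof (rule sympI)
    fix s t
    assume "tensor_eq s t"
    hence "s - t \<in> tensor_relations" by (simp only: tensor_eq_def)
    from Q.subspace_neg[OF tensor_relations_subspace this] show "tensor_eq t s"
      by (simp add: tensor_eq_def)
  qed
  show "transp tensor_eq"
  proof (rule transpI)
    fix s t u
    assume "tensor_eq s t" "tensor_eq t u"
    hence "s - t \<in> tensor_relations" "t - u \<in> tensor_relations" by (simp_all only: tensor_eq_def)
    from Q.subspace_add[OF tensor_relations_subspace this] show "tensor_eq s u"
      by (simp add: tensor_eq_def)
  qed
qed

quotient_type (overloaded) ('a, 'b) tensor (infixr \<open>\<otimes>\<close> 71)
  = "'a::rat_vector \<times> 'b::rat_vector \<Rightarrow>\<^sub>0 rat" / tensor_eq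
  by (rule tensor_eq_equivp)

instantiation tensor :: (rat_vector, rat_vector) rat_vector
begin

lift_definition zero_tensor :: "'a \<otimes> 'b" is 0 .

lift_definition plus_tensor :: "'a \<otimes> 'b \<Rightarrow> 'a \<otimes> 'b \<Rightarrow> 'a \<otimes> 'b" is "(+)"
proof -
  fix a b c d :: "'a \<times> 'b \<Rightarrow>\<^sub>0 rat"
  assume "tensor_eq a b" "tensor_eq c d"
  moreover have "(a + c) - (b + d) = (a - b) + (c - d)" by simp
  ultimately show "tensor_eq (a + c) (b + d)"
    unfolding tensor_eq_def by (simp only: Q.subspace_add[OF tensor_relations_subspace])
qed

lift_definition minus_tensor :: "'a \<otimes> 'b \<Rightarrow> 'a \<otimes> 'b \<Rightarrow> 'a \<otimes> 'b" is "(-)"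
proof -
  fix a b c d :: "'a \<times> 'b \<Rightarrow>\<^sub>0 rat"
  assume "tensor_eq a b" "tensor_eq c d"
  moreover have "(a - c) - (b - d) = (a - b) - (c - d)" by simp
  ultimately show "tensor_eq (a - c) (b - d)"
    unfolding tensor_eq_def by (simp only: Q.subspace_diff[OF tensor_relations_subspace])
qed

lift_definition uminus_tensor :: "'a \<otimes> 'b \<Rightarrow> 'a \<otimes> 'b" is "uminus"
proof -
  fix a b :: "'a \<times> 'b \<Rightarrow>\<^sub>0 rat"
  assume "tensor_eq a b"
  moreover have "- a - - b = - (a - b)" by simp
  ultimately show "tensor_eq (- a) (- b)"
    unfolding tensor_eq_def by (simp only: Q.subspace_neg[OF tensor_relations_subspace])
qed

lift_definition scaleQ_tensor :: "rat \<Rightarrow> 'a \<otimes> 'b \<Rightarrow> 'a \<otimes> 'b" is "scaleQ"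
  unfolding tensor_eq_def
  by (simp only: Q.scale_right_diff_distrib[symmetric] Q.subspace_scale[OF tensor_relations_subspace])

lemma tensor_eq_refl: "s = t \<Longrightarrow> tensor_eq s t"
  by (simp add: tensor_eq_def Q.subspace_0[OF tensor_relations_subspace])

instance
  by standard
     (transfer; rule tensor_eq_refl;
        simp add: algebra_simps scaleQ_add_right scaleQ_add_left scaleQ_one)+

end

lift_definition pure_tensor :: "'a::rat_vector \<Rightarrow> 'b::rat_vector \<Rightarrow> 'a \<otimes> 'b" (infixr \<open>\<otimes>\<^sub>p\<close> 71)
  is "\<lambda>a b. Poly_Mapping.single (a, b) 1" .

lemma pure_tensor_bilinear: "qbilinear (\<otimes>\<^sub>p)"
  unfolding qbilinear_def
proof (intro allI conjI qlinearI)
  fix a x y c and b :: "'b" and a2 :: 'a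
  show "a2 \<otimes>\<^sub>p (x + y) = a2 \<otimes>\<^sub>p x + a2 \<otimes>\<^sub>p (y::'b)"
    apply transfer
    unfolding tensor_eq_def tensor_relations_def diff_diff_eq[symmetric]
    by (rule Q.span_base) blast
  show "a2 \<otimes>\<^sub>p (c *\<^sub>Q x) = c *\<^sub>Q (a2 \<otimes>\<^sub>p (x :: 'b))"
    apply transfer
    unfolding tensor_eq_def tensor_relations_def
    by (rule Q.span_base) blast
next
  fix a x y :: 'a and b :: 'b and c
  show "(x + y) \<otimes>\<^sub>p b = x \<otimes>\<^sub>p b + y \<otimes>\<^sub>p b"
    apply transfer
    unfolding tensor_eq_def tensor_relations_def diff_diff_eq[symmetric]
    by (rule Q.span_base) blast
  show "(c *\<^sub>Q x) \<otimes>\<^sub>p b = c *\<^sub>Q (x \<otimes>\<^sub>p b)"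
    apply transfer
    unfolding tensor_eq_def tensor_relations_def
    by (rule Q.span_base) blast
qed

lemma span_pure_tensors: "Q.span {a \<otimes>\<^sub>p b | a b. True} = (UNIV :: ('a::rat_vector \<otimes> 'b::rat_vector) set)"
proof -
  have "t \<in> Q.span {a \<otimes>\<^sub>p b | a b. True}" for t :: "'a \<otimes> 'b"
  proof -
    obtain s where s: "t = abs_tensor s" by (metis Quotient_abs_rep[OF Quotient_tensor])
    have "abs_tensor s \<in> Q.span {a \<otimes>\<^sub>p b | a b. True}"
    proof (induction s rule: update_induct)
      case const
      show ?case by (simp add: zero_tensor.abs_eq[symmetric] Q.span_zero)
    next
      case (update f k v)
      obtain a b where k: "k = (a, b)" by (cases k)
      have "Poly_Mapping.update k v f = f + v *\<^sub>Q Poly_Mapping.single (a, b) (1::rat)"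
        using update(1)
        by (intro poly_mapping_eqI)
           (auto simp: k lookup_add lookup_update scaleQ_poly_mapping.rep_eq scaleQ_rat_def
              lookup_single when_def in_keys_iff)
      hence "abs_tensor (Poly_Mapping.update k v f) = abs_tensor f + v *\<^sub>Q (a \<otimes>\<^sub>p b)"
        by (simp add: pure_tensor.abs_eq scaleQ_tensor.abs_eq plus_tensor.abs_eq)
      moreover have "a \<otimes>\<^sub>p b \<in> Q.span {a \<otimes>\<^sub>p b | a b. True}"
        by (rule Q.span_base) blast
      ultimately show ?case
        using update(3) by (simp add: Q.span_add Q.span_scale)
    qed
    thus ?thesis by (simp add: s)
  qed
  thus ?thesis by blast
qed

text \<open>The linear map induced by a bilinear map (universal property of the tensor product).\<close>

definition tensor_lift ::
    "('a::rat_vector \<Rightarrow> 'b::rat_vector \<Rightarrow> 'c::rat_vector) \<Rightarrow> 'a \<otimes> 'b \<Rightarrow> 'c" where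
  "tensor_lift \<beta> = (THE h. qlinear h \<and> (\<forall>a b. h (a \<otimes>\<^sub>p b) = \<beta> a b))"

lemma tensor_lift_ex1:
  fixes \<beta> :: "'a::rat_vector \<Rightarrow> 'b::rat_vector \<Rightarrow> 'c::rat_vector"
  assumes "qbilinear \<beta>"
  shows "\<exists>!h. qlinear h \<and> (\<forall>a b. h (a \<otimes>\<^sub>p b) = \<beta> a b)"
proof -
  define H where "H = (\<lambda>s. \<Sum>k\<in>Poly_Mapping.keys s. Poly_Mapping.lookup s k *\<^sub>Q \<beta> (fst k) (snd k))"
  have H_eq: "H s = (\<Sum>k\<in>A. Poly_Mapping.lookup s k *\<^sub>Q \<beta> (fst k) (snd k))"
    if "finite A" "Poly_Mapping.keys s \<subseteq> A" for s A
    unfolding H_def using that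
    by (intro sum.mono_neutral_left) (auto simp: in_keys_iff)
  have H_add: "H (s + t) = H s + H t" for s t
  proof -
    let ?A = "Poly_Mapping.keys s \<union> Poly_Mapping.keys t"
    have "Poly_Mapping.keys (s + t) \<subseteq> ?A" by (rule Poly_Mapping.keys_add)
    thus ?thesis
      by (simp add: H_eq[of ?A] sum.distrib lookup_add scaleQ_add_left)
  qed
  have H_scale: "H (c *\<^sub>Q s) = c *\<^sub>Q H s" for c s
  proof -
    have "Poly_Mapping.keys (c *\<^sub>Q s) \<subseteq> Poly_Mapping.keys s"
      by (auto simp: in_keys_iff scaleQ_poly_mapping.rep_eq)
    thus ?thesis
      by (simp add: H_eq[of "Poly_Mapping.keys s"] scaleQ_poly_mapping.rep_eq
            scaleQ_rat_def Q.scale_sum_right)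
  qed
  have linH: "qlinear H" by (intro qlinearI H_add H_scale)
  have H_single: "H (Poly_Mapping.single (a, b) 1) = \<beta> a b" for a b
    by (simp add: H_def scaleQ_one)
  have b1: "\<beta> (a + a') b = \<beta> a b + \<beta> a' b" "\<beta> (c *\<^sub>Q a) b = c *\<^sub>Q \<beta> a b"
    "\<beta> a (b + b') = \<beta> a b + \<beta> a b'" "\<beta> a (c *\<^sub>Q b) = c *\<^sub>Q \<beta> a b" for a a' b b' c
    using assms by (auto simp: qbilinear_def qlinear_iff)
  have ker: "H s = 0" if "s \<in> tensor_relations" for s
  proof (rule qlinear_eq_on_span[OF linH _ _ that[unfolded tensor_relations_def], of "\<lambda>_. 0"])
    show "qlinear (\<lambda>_::'a \<times> 'b \<Rightarrow>\<^sub>0 rat. 0::'c)" by (rule qlinearI) auto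
  qed (auto simp: qlinear_diff[OF linH] H_single H_scale b1)
  have resp: "H s = H t" if "tensor_eq s t" for s t
    using ker[OF that[unfolded tensor_eq_def]] by (simp add: qlinear_diff[OF linH])
  define h where "h = (\<lambda>t. H (rep_tensor t))"
  have h_abs: "h (abs_tensor s) = H s" for s
    unfolding h_def
    by (rule resp) (rule rep_abs_rsp_left[OF Quotient3_tensor equivp_reflp[OF tensor_equivp]])
  have h_pure: "h (a \<otimes>\<^sub>p b) = \<beta> a b" for a b
    by (simp add: pure_tensor.abs_eq h_abs H_single)
  have h_lin: "qlinear h"
  proof (rule qlinearI)
    fix x y c
    show "h (x + y) = h x + h y"
      by (metis H_add Quotient3_abs_rep Quotient3_tensor h_abs plus_tensor.abs_eq)
    show "h (c *\<^sub>Q x) = c *\<^sub>Q h x"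
      by (metis H_scale Quotient3_abs_rep Quotient3_tensor h_abs scaleQ_tensor.abs_eq)
  qed
  show ?thesis
  proof (rule ex1I[of _ h])
    fix h' assume h': "qlinear h' \<and> (\<forall>a b. h' (a \<otimes>\<^sub>p b) = \<beta> a b)"
    show "h' = h"
    proof
      fix t :: "'a \<otimes> 'b"
      have "t \<in> Q.span {a \<otimes>\<^sub>p b | a b. True}"
        unfolding span_pure_tensors by (rule UNIV_I)
      thus "h' t = h t"
        by (rule qlinear_eq_on_span[rotated -1]) (use h' h_lin h_pure in auto)
    qed
  qed (use h_lin h_pure in auto)
qed

lemma
  assumes "qbilinear \<beta>"
  shows tensor_lift_linear: "qlinear (tensor_lift \<beta>)"
    and tensor_lift_pure: "tensor_lift \<beta> (a \<otimes>\<^sub>p b) = \<beta> a b"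
  using theI'[OF tensor_lift_ex1[OF assms]] by (auto simp: tensor_lift_def)

definition tensor_map ::
    "('a::rat_vector \<Rightarrow> 'c::rat_vector) \<Rightarrow> ('b::rat_vector \<Rightarrow> 'd::rat_vector) \<Rightarrow> 'a \<otimes> 'b \<Rightarrow> 'c \<otimes> 'd"
  where "tensor_map f g = tensor_lift (\<lambda>a b. f a \<otimes>\<^sub>p g b)"

definition tensor_assoc ::
    "('a::rat_vector \<otimes> 'b::rat_vector) \<otimes> 'c::rat_vector \<Rightarrow> 'a \<otimes> 'b \<otimes> 'c"
  where "tensor_assoc = tensor_lift (\<lambda>s c. tensor_lift (\<lambda>a b. a \<otimes>\<^sub>p b \<otimes>\<^sub>p c) s)"

text \<open>The product \<open>(a \<otimes> b) (c \<otimes> d) = ac \<otimes> bd\<close> on the tensor product of two algebras.\<close>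

definition tensor_mult ::
    "('a::rat_vector \<Rightarrow> 'a \<Rightarrow> 'a) \<Rightarrow> ('b::rat_vector \<Rightarrow> 'b \<Rightarrow> 'b) \<Rightarrow> 'a \<otimes> 'b \<Rightarrow> 'a \<otimes> 'b \<Rightarrow> 'a \<otimes> 'b"
  where "tensor_mult \<mu> \<nu> s t =
    tensor_lift (\<lambda>a b. tensor_lift (\<lambda>c d. \<mu> a c \<otimes>\<^sub>p \<nu> b d) t) s"

lemma qlinear_compose: "qlinear f \<Longrightarrow> qlinear g \<Longrightarrow> qlinear (\<lambda>x. g (f x))"
  by (simp add: qlinear_iff)

lemma pure_tensor_linear_right: "qlinear (\<lambda>b. a \<otimes>\<^sub>p b)"
  and pure_tensor_linear_left: "qlinear (\<lambda>a. a \<otimes>\<^sub>p b)"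
  using pure_tensor_bilinear by (auto simp: qbilinear_def)

lemma tensor_eqI:
  assumes "qlinear f" "qlinear g" "\<And>a b. f (a \<otimes>\<^sub>p b) = g (a \<otimes>\<^sub>p b)"
  shows "f t = g t"
proof (rule qlinear_eq_on_span[OF assms(1,2)])
  show "t \<in> Q.span {a \<otimes>\<^sub>p b | a b. True}" unfolding span_pure_tensors by (rule UNIV_I)
qed (auto simp: assms(3))

lemma tensor_map_bilinear:
  assumes "qlinear f" "qlinear g"
  shows "qbilinear (\<lambda>a b. f a \<otimes>\<^sub>p g b)"
  unfolding qbilinear_def
  using qlinear_compose[OF assms(2) pure_tensor_linear_right]
    qlinear_compose[OF assms(1) pure_tensor_linear_left] by blast

lemma
  assumes "qlinear f" "qlinear g"
  shows tensor_map_linear: "qlinear (tensor_map f g)"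
    and tensor_map_pure: "tensor_map f g (a \<otimes>\<^sub>p b) = f a \<otimes>\<^sub>p g b"
  unfolding tensor_map_def
  by (simp_all add: tensor_lift_linear tensor_lift_pure tensor_map_bilinear assms)

lemma qlinear_plus: "qlinear f \<Longrightarrow> qlinear g \<Longrightarrow> qlinear (\<lambda>x. f x + g x)"
  by (simp add: qlinear_iff scaleQ_add_right algebra_simps)

lemma qlinear_cmult: "qlinear f \<Longrightarrow> qlinear (\<lambda>x. c *\<^sub>Q f x)"
  by (simp add: qlinear_iff scaleQ_add_right mult.commute)

lemma tensor_lift_family_linear:
  assumes "\<And>z. qbilinear (\<beta> z)" "\<And>a b. qlinear (\<lambda>z. \<beta> z a b)"
  shows "qlinear (\<lambda>z. tensor_lift (\<beta> z) t)"
proof (rule qlinearI)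
  fix x y c
  note lin = tensor_lift_linear[OF assms(1)] and pure = tensor_lift_pure[OF assms(1)]
  show "tensor_lift (\<beta> (x + y)) t = tensor_lift (\<beta> x) t + tensor_lift (\<beta> y) t"
    by (rule tensor_eqI[OF lin qlinear_plus[OF lin lin]])
       (simp only: pure qlinear_add[OF assms(2)])
  show "tensor_lift (\<beta> (c *\<^sub>Q x)) t = c *\<^sub>Q tensor_lift (\<beta> x) t"
    by (rule tensor_eqI[OF lin qlinear_cmult[OF lin]])
       (simp only: pure qlinear_scale[OF assms(2)])
qed

lemma tensor_assoc_inner_bilinear: "qbilinear (\<lambda>a b. a \<otimes>\<^sub>p b \<otimes>\<^sub>p c)"
  unfolding qbilinear_def
  by (auto intro!: pure_tensor_linear_left
        qlinear_compose[OF pure_tensor_linear_left pure_tensor_linear_right])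

lemma tensor_assoc_bilinear: "qbilinear (\<lambda>s c. tensor_lift (\<lambda>a b. a \<otimes>\<^sub>p b \<otimes>\<^sub>p c) s)"
  unfolding qbilinear_def
  by (auto intro!: tensor_lift_family_linear tensor_lift_linear tensor_assoc_inner_bilinear
        qlinear_compose[OF pure_tensor_linear_right pure_tensor_linear_right])

lemma tensor_assoc_linear: "qlinear tensor_assoc"
  and tensor_assoc_pure: "tensor_assoc ((a \<otimes>\<^sub>p b) \<otimes>\<^sub>p c) = a \<otimes>\<^sub>p b \<otimes>\<^sub>p c"
  unfolding tensor_assoc_def
  by (simp_all add: tensor_lift_linear tensor_lift_pure tensor_assoc_bilinear
        tensor_assoc_inner_bilinear)

lemma
  assumes "qbilinear \<mu>" "qbilinear \<nu>"
  shows tensor_mult_bilinear: "qbilinear (tensor_mult \<mu> \<nu>)"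
    and tensor_mult_pure: "tensor_mult \<mu> \<nu> (a \<otimes>\<^sub>p b) (c \<otimes>\<^sub>p d) = \<mu> a c \<otimes>\<^sub>p \<nu> b d"
proof -
  have lin: "qlinear (\<mu> a)" "qlinear (\<lambda>a. \<mu> a c)" "qlinear (\<nu> b)" "qlinear (\<lambda>b. \<nu> b d)" for a b c d
    using assms by (simp_all add: qbilinear_def)
  have inner: "qbilinear (\<lambda>c d. \<mu> a c \<otimes>\<^sub>p \<nu> b d)" for a b
    by (rule tensor_map_bilinear) (rule lin)+
  have outer: "qbilinear (\<lambda>a b. tensor_lift (\<lambda>c d. \<mu> a c \<otimes>\<^sub>p \<nu> b d) t)" for t
    unfolding qbilinear_def
    by (intro allI conjI tensor_lift_family_linear inner
          qlinear_compose[OF lin(4) pure_tensor_linear_right]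
          qlinear_compose[OF lin(2) pure_tensor_linear_left])
  have swap: "qlinear (\<lambda>t. tensor_mult \<mu> \<nu> s t)" for s
  proof -
    have eq: "qlinear (\<lambda>t. tensor_lift (\<lambda>a b. tensor_lift (\<lambda>c d. \<mu> a c \<otimes>\<^sub>p \<nu> b d) t) s)"
      by (rule tensor_lift_family_linear[OF outer]) (rule tensor_lift_linear[OF inner])
    thus ?thesis by (simp add: tensor_mult_def)
  qed
  show "qbilinear (tensor_mult \<mu> \<nu>)"
    unfolding qbilinear_def
  proof (intro allI conjI)
    show "qlinear (\<lambda>s. tensor_mult \<mu> \<nu> s t)" for t
      using tensor_lift_linear[OF outer] by (simp add: tensor_mult_def)
  qed (rule swap)
  show "tensor_mult \<mu> \<nu> (a \<otimes>\<^sub>p b) (c \<otimes>\<^sub>p d) = \<mu> a c \<otimes>\<^sub>p \<nu> b d"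
    unfolding tensor_mult_def
    by (rule trans[OF tensor_lift_pure[OF outer] tensor_lift_pure[OF inner]])
qed

section \<open>Graded Hopf algebras over the rationals\<close>

locale rat_algebra =
  fixes mult :: "'a::rat_vector \<Rightarrow> 'a \<Rightarrow> 'a" and unit :: 'a
  assumes mult_bilinear: "qbilinear mult"
    and mult_assoc: "mult (mult x y) z = mult x (mult y z)"
    and mult_unit_left: "mult unit x = x"
    and mult_unit_right: "mult x unit = x"

locale rat_coalgebra =
  fixes comult :: "'a::rat_vector \<Rightarrow> 'a \<otimes> 'a" and counit :: "'a \<Rightarrow> rat"
  assumes comult_linear: "qlinear comult"
    and counit_linear: "qlinear counit"
    and coassoc: "tensor_assoc (tensor_map comult id (comult x)) = tensor_map id comult (comult x)"
    and counit_left: "tensor_lift (\<lambda>a b. counit a *\<^sub>Q b) (comult x) = x"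
    and counit_right: "tensor_lift (\<lambda>a b. counit b *\<^sub>Q a) (comult x) = x"

locale rat_bialgebra = rat_algebra mult unit + rat_coalgebra comult counit
  for mult :: "'a::rat_vector \<Rightarrow> 'a \<Rightarrow> 'a" and unit comult counit +
  assumes comult_mult: "comult (mult x y) = tensor_mult mult mult (comult x) (comult y)"
    and comult_unit: "comult unit = unit \<otimes>\<^sub>p unit"
    and counit_mult: "counit (mult x y) = counit x * counit y"
    and counit_unit: "counit unit = 1"

definition is_antipode ::
    "('a::rat_vector \<Rightarrow> 'a \<Rightarrow> 'a) \<Rightarrow> 'a \<Rightarrow> ('a \<Rightarrow> 'a \<otimes> 'a) \<Rightarrow> ('a \<Rightarrow> rat) \<Rightarrow> ('a \<Rightarrow> 'a) \<Rightarrow> bool" where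
  "is_antipode mult unit comult counit S \<longleftrightarrow>
     qlinear S \<and>
     (\<forall>x. tensor_lift mult (tensor_map S id (comult x)) = counit x *\<^sub>Q unit) \<and>
     (\<forall>x. tensor_lift mult (tensor_map id S (comult x)) = counit x *\<^sub>Q unit)"

locale rat_hopf_algebra = rat_bialgebra +
  assumes antipode_exists: "\<exists>S. is_antipode mult unit comult counit S"

text \<open>\<open>V\<close> is a direct sum decomposition of the whole space into subspaces.\<close>

definition is_grading :: "('g \<Rightarrow> 'a::rat_vector set) \<Rightarrow> bool" where
  "is_grading V \<longleftrightarrow>
     (\<forall>g. Q.subspace (V g)) \<and>
     (\<forall>x. \<exists>!c :: 'g \<Rightarrow>\<^sub>0 'a. (\<forall>g. Poly_Mapping.lookup c g \<in> V g) \<and>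
        x = (\<Sum>g\<in>Poly_Mapping.keys c. Poly_Mapping.lookup c g))"

text \<open>A bigraded Hopf algebra is the case \<open>'g = nat \<times> nat\<close>, a graded one the case \<open>'g = nat\<close>.\<close>

locale graded_hopf_algebra = rat_hopf_algebra mult unit comult counit
  for mult :: "'a::rat_vector \<Rightarrow> 'a \<Rightarrow> 'a" and unit comult counit +
  fixes V :: "'g::comm_monoid_add \<Rightarrow> 'a set"
  assumes grading: "is_grading V"
    and mult_graded: "x \<in> V g \<Longrightarrow> y \<in> V h \<Longrightarrow> mult x y \<in> V (g + h)"
    and unit_graded: "unit \<in> V 0"
    and comult_graded: "x \<in> V g \<Longrightarrow>
      comult x \<in> Q.span {a \<otimes>\<^sub>p b | a b h k. h + k = g \<and> a \<in> V h \<and> b \<in> V k}"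
    and counit_graded: "x \<in> V g \<Longrightarrow> g \<noteq> 0 \<Longrightarrow> counit x = 0"
    and antipode_graded: "is_antipode mult unit comult counit S \<Longrightarrow> x \<in> V g \<Longrightarrow> S x \<in> V g"

locale graded_hopf_morphism =
  A: graded_hopf_algebra mult\<^sub>A unit\<^sub>A comult\<^sub>A counit\<^sub>A V +
  B: graded_hopf_algebra mult\<^sub>B unit\<^sub>B comult\<^sub>B counit\<^sub>B W
  for mult\<^sub>A :: "'a::rat_vector \<Rightarrow> 'a \<Rightarrow> 'a" and unit\<^sub>A comult\<^sub>A counit\<^sub>A
    and V :: "'g::comm_monoid_add \<Rightarrow> 'a set"
    and mult\<^sub>B :: "'b::rat_vector \<Rightarrow> 'b \<Rightarrow> 'b" and unit\<^sub>B comult\<^sub>B counit\<^sub>B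
    and W :: "'g \<Rightarrow> 'b set" +
  fixes \<phi> :: "'a \<Rightarrow> 'b"
  assumes linear: "qlinear \<phi>"
    and map_mult: "\<phi> (mult\<^sub>A x y) = mult\<^sub>B (\<phi> x) (\<phi> y)"
    and map_unit: "\<phi> unit\<^sub>A = unit\<^sub>B"
    and map_comult: "comult\<^sub>B (\<phi> x) = tensor_map \<phi> \<phi> (comult\<^sub>A x)"
    and map_counit: "counit\<^sub>B (\<phi> x) = counit\<^sub>A x"
    and map_antipode: "is_antipode mult\<^sub>A unit\<^sub>A comult\<^sub>A counit\<^sub>A S \<Longrightarrow>
      is_antipode mult\<^sub>B unit\<^sub>B comult\<^sub>B counit\<^sub>B T \<Longrightarrow> \<phi> (S x) = T (\<phi> x)"
    and map_graded: "x \<in> V g \<Longrightarrow> \<phi> x \<in> W g"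

section \<open>Formal series\<close>

text \<open>
  Exponents \<open>'e\<close> of the variables at one index: \<open>nat\<close> for a single alphabet \<open>x\<^sub>0, x\<^sub>1, \<dots>\<close>, and
  \<open>nat \<times> nat\<close> for two alphabets, \<open>(a, b)\<close> standing for \<open>x\<^sub>i\<^sup>a y\<^sub>i\<^sup>b\<close>. A monomial is a finitely
  supported function from indices to exponents, and multiplying monomials adds exponents. Indices
  start at \<open>0\<close> instead of \<open>1\<close>.
\<close>

class exponent = cancel_comm_monoid_add +
  assumes add_eq_zeroD: "a + b = 0 \<Longrightarrow> a = 0"
    and finite_decompositions: "finite {(a, b). a + b = c}"

instance nat :: exponent
proof
  fix c :: nat
  have "{(a, b). a + b = c} \<subseteq> {..c} \<times> {..c}" by auto
  thus "finite {(a, b). a + b = c}" by (rule finite_subset) auto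
qed auto

instance prod :: (exponent, exponent) exponent
proof
  fix a b :: "'a \<times> 'b"
  assume "a + b = 0"
  thus "a = 0"
    by (cases a, cases b) (auto simp: zero_prod_def dest: add_eq_zeroD)
next
  fix c :: "'a \<times> 'b"
  let ?f = "\<lambda>((a, a'), (b, b')). ((a, b), (a', b'))"
  have "{(a, b). a + b = c} \<subseteq> ?f ` ({(a, b). a + b = fst c} \<times> {(a, b). a + b = snd c})"
    by (force simp: image_iff)
  thus "finite {(a, b). a + b = c}"
    by (rule finite_subset) (intro finite_imageI finite_cartesian_product finite_decompositions)
qed

lemma add_eq_zero_iff: "a + b = 0 \<longleftrightarrow> a = 0 \<and> b = 0" for a b :: "'a::exponent"
  using add_eq_zeroD[of a b] add_eq_zeroD[of b a] by (auto simp: add.commute[of b a])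

lemma keys_add_exponent:
  fixes p q :: "'k \<Rightarrow>\<^sub>0 'e::exponent"
  shows "Poly_Mapping.keys (p + q) = Poly_Mapping.keys p \<union> Poly_Mapping.keys q"
  by (auto simp: in_keys_iff lookup_add add_eq_zero_iff)

instance poly_mapping :: (type, exponent) exponent
proof
  fix a b :: "'a \<Rightarrow>\<^sub>0 'b"
  assume "a + b = 0"
  hence "Poly_Mapping.keys a \<union> Poly_Mapping.keys b = {}"
    by (metis keys_add_exponent keys_zero)
  thus "a = 0" by simp
next
  fix c :: "'a \<Rightarrow>\<^sub>0 'b"
  define E where "E = (\<Union>k\<in>Poly_Mapping.keys c. fst ` {(a, b). a + b = Poly_Mapping.lookup c k})"
  define F where "F = {f. \<forall>k. (k \<in> Poly_Mapping.keys c \<longrightarrow> f k \<in> E) \<and>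
      (k \<notin> Poly_Mapping.keys c \<longrightarrow> f k = 0)}"
  have finF: "finite F"
    unfolding F_def
    by (rule finite_set_of_finite_funs) (auto simp: E_def intro!: finite_decompositions)
  let ?g = "\<lambda>f. (Poly_Mapping.Abs_poly_mapping f, c - Poly_Mapping.Abs_poly_mapping f)"
  have "{(a, b). a + b = c} \<subseteq> ?g ` F"
  proof
    fix x assume "x \<in> {(a, b). a + b = c}"
    then obtain a b where x: "x = (a, b)" and c: "c = a + b" by auto
    have F: "Poly_Mapping.lookup a \<in> F"
      by (auto simp: F_def E_def c keys_add_exponent lookup_add in_keys_iff image_iff add_eq_zero_iff)
    show "x \<in> ?g ` F"
      by (rule image_eqI[OF _ F]) (simp add: c x)
  qed
  thus "finite {(a, b). a + b = c}" using finF by (meson finite_imageI finite_subset)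
qed

typedef 'm series = "UNIV :: ('m \<Rightarrow> rat) set" morphisms coeff Series ..

setup_lifting type_definition_series

lemma coeff_Series [simp]: "coeff (Series f) m = f m"
  by (simp add: Series_inverse)

lemma series_eqI: "(\<And>m. coeff f m = coeff g m) \<Longrightarrow> f = g"
  by (metis coeff_inject ext)

instantiation series :: (type) rat_vector
begin
lift_definition zero_series :: "'a series" is "\<lambda>_. 0" .
lift_definition plus_series :: "'a series \<Rightarrow> 'a series \<Rightarrow> 'a series" is "\<lambda>f g m. f m + g m" .
lift_definition minus_series :: "'a series \<Rightarrow> 'a series \<Rightarrow> 'a series" is "\<lambda>f g m. f m - g m" .
lift_definition uminus_series :: "'a series \<Rightarrow> 'a series" is "\<lambda>f m. - f m" .
lift_definition scaleQ_series :: "rat \<Rightarrow> 'a series \<Rightarrow> 'a series" is "\<lambda>c f m. c * f m" .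
instance by standard (transfer; simp add: fun_eq_iff algebra_simps)+
end

instantiation series :: (exponent) "{one, times}"
begin
lift_definition one_series :: "'a series" is "\<lambda>m. if m = 0 then 1 else 0" .
lift_definition times_series :: "'a series \<Rightarrow> 'a series \<Rightarrow> 'a series"
  is "\<lambda>f g m. \<Sum>(p, q)\<in>{(p, q). p + q = m}. f p * g q" .
instance ..
end

lemma series_mult_bilinear: "qbilinear ((*) :: 'm::exponent series \<Rightarrow> 'm series \<Rightarrow> 'm series)"
  unfolding qbilinear_def
proof (intro allI conjI qlinearI)
  fix f g h :: "'m series" and c
  show "h * (f + g) = h * f + h * g" "(f + g) * h = f * h + g * h"
    by (transfer; force simp: algebra_simps sum.distrib split_beta)+
  show "h * (c *\<^sub>Q f) = c *\<^sub>Q (h * f)" "(c *\<^sub>Q f) * h = c *\<^sub>Q (f * h)"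
    by (transfer; force simp: sum_distrib_left mult_ac split_beta)+
qed

section \<open>Diagonally quasi-symmetric series\<close>

text \<open>Compositions (\<open>'e = nat\<close>) and bicompositions (\<open>'e = nat \<times> nat\<close>).\<close>

definition compositions :: "'e::zero list set" where
  "compositions = {as. 0 \<notin> set as}"

text \<open>The monomial with exponents \<open>as\<close> at the indices \<open>is\<close>.\<close>

definition monomial_at :: "nat list \<Rightarrow> 'e::exponent list \<Rightarrow> (nat \<Rightarrow>\<^sub>0 'e)" where
  "monomial_at is as = (\<Sum>j<length as. Poly_Mapping.single (is ! j) (as ! j))"

text \<open>
  The sum over all \<open>i\<^sub>1 < \<dots> < i\<^sub>k\<close> of the monomials with exponents \<open>as\<close> at these indices, as a
  formal series: the coefficient of \<open>m\<close> counts the index sequences yielding \<open>m\<close>.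
\<close>

definition M_series :: "'e::exponent list \<Rightarrow> (nat \<Rightarrow>\<^sub>0 'e) series" where
  "M_series as = Series (\<lambda>m. of_nat (card {is.
     length is = length as \<and> sorted_wrt (<) is \<and> monomial_at is as = m}))"

definition packed :: "(nat \<Rightarrow>\<^sub>0 'e::zero) \<Rightarrow> 'e list" where
  "packed m = map (Poly_Mapping.lookup m) (sorted_list_of_set (Poly_Mapping.keys m))"

lemma packed_composition: "packed m \<in> compositions"
  by (auto simp: packed_def compositions_def in_keys_iff)

lemma sum_if_nonzeroD:
  assumes "(\<Sum>j<n. if P j then f j else 0) \<noteq> 0" shows "\<exists>j<n. P j"
proof (rule ccontr)
  assume "\<not> (\<exists>j<n. P j)"
  hence "(\<Sum>j<n. if P j then f j else 0) = 0" by (intro sum.neutral) auto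
  thus False using assms by contradiction
qed

lemma lookup_monomial_at:
  assumes "length is = length as" "distinct is"
  shows "Poly_Mapping.lookup (monomial_at is as) k =
    (\<Sum>j<length as. if is ! j = k then as ! j else 0)"
  unfolding monomial_at_def lookup_sum by (auto simp: lookup_single when_def)

lemma lookup_monomial_at_nth:
  assumes "length is = length as" "distinct is" "i < length as"
  shows "Poly_Mapping.lookup (monomial_at is as) (is ! i) = as ! i"
proof -
  have "(\<Sum>j<length as. if is ! j = is ! i then as ! j else 0) =
      (\<Sum>j<length as. if j = i then as ! j else 0)"
    using assms by (intro sum.cong) (auto simp: nth_eq_iff_index_eq)
  thus ?thesis using assms by (simp add: lookup_monomial_at)
qed

lemma keys_monomial_at:
  assumes "length is = length as" "distinct is" "as \<in> compositions"
  shows "Poly_Mapping.keys (monomial_at is as) = set is"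
proof (intro set_eqI iffI)
  fix k assume "k \<in> Poly_Mapping.keys (monomial_at is as)"
  hence "(\<Sum>j<length as. if is ! j = k then as ! j else 0) \<noteq> 0"
    by (simp add: in_keys_iff lookup_monomial_at assms)
  from sum_if_nonzeroD[OF this] obtain j where "j < length as" "is ! j = k"
    by blast
  thus "k \<in> set is" using assms(1) by auto
next
  fix k assume "k \<in> set is"
  then obtain j where j: "j < length as" "k = is ! j"
    using assms(1) by (metis in_set_conv_nth)
  thus "k \<in> Poly_Mapping.keys (monomial_at is as)"
    using assms by (auto simp: in_keys_iff lookup_monomial_at_nth compositions_def)
      (metis nth_mem)
qed

lemma monomial_at_packed:
  "monomial_at (sorted_list_of_set (Poly_Mapping.keys m)) (packed m) = m"
proof (rule poly_mapping_eqI)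
  fix k
  let ?is = "sorted_list_of_set (Poly_Mapping.keys m)"
  have len: "length ?is = length (packed m)" by (simp add: packed_def)
  have ks: "Poly_Mapping.keys (monomial_at ?is (packed m)) = Poly_Mapping.keys m"
    by (subst keys_monomial_at[OF len _ packed_composition]) simp_all
  show "Poly_Mapping.lookup (monomial_at ?is (packed m)) k = Poly_Mapping.lookup m k"
  proof (cases "k \<in> Poly_Mapping.keys m")
    case True
    then obtain j where j: "j < length ?is" "k = ?is ! j"
      by (metis finite_keys in_set_conv_nth set_sorted_list_of_set)
    thus ?thesis
      using lookup_monomial_at_nth[OF len _, of j] len by (simp add: packed_def)
  next
    case False
    thus ?thesis using ks by (metis in_keys_iff)
  qed
qed

lemma packed_monomial_at:
  assumes "length is = length as" "sorted_wrt (<) is" "as \<in> compositions"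
  shows "packed (monomial_at is as) = as"
    and "sorted_list_of_set (Poly_Mapping.keys (monomial_at is as)) = is"
proof -
  have d: "distinct is" using assms(2) by (simp add: strict_sorted_iff)
  show *: "sorted_list_of_set (Poly_Mapping.keys (monomial_at is as)) = is"
    using assms d by (simp add: keys_monomial_at sorted_list_of_set.idem_if_sorted_distinct
        strict_sorted_iff)
  show "packed (monomial_at is as) = as"
    unfolding packed_def *
    using assms d by (intro nth_equalityI) (auto simp: lookup_monomial_at_nth)
qed

lemma coeff_M_series:
  assumes "as \<in> compositions"
  shows "coeff (M_series as) m = (if packed m = as then 1 else 0)"
proof -
  let ?A = "{is. length is = length as \<and> sorted_wrt (<) is \<and> monomial_at is as = m}"
  have "?A = (if packed m = as then {sorted_list_of_set (Poly_Mapping.keys m)} else {})"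
  proof (cases "packed m = as")
    case True
    have "sorted_list_of_set (Poly_Mapping.keys m) \<in> ?A"
      using monomial_at_packed[of m] unfolding True
      by (simp add: True[symmetric] packed_def)
    moreover have "is = sorted_list_of_set (Poly_Mapping.keys m)" if "is \<in> ?A" for "is"
      using packed_monomial_at(2)[of "is" as] that assms by simp
    ultimately show ?thesis using True by auto
  next
    case False
    thus ?thesis using packed_monomial_at(1)[OF _ _ assms] by auto
  qed
  hence "card ?A = (if packed m = as then 1 else 0)" by simp
  thus ?thesis by (simp add: M_series_def)
qed

lemma M_series_Nil: "M_series [] = 1"
  by (rule series_eqI)
     (auto simp: coeff_M_series compositions_def packed_def one_series.rep_eq)

text \<open>The product of two spans of \<open>M_series\<close> is again contained in the span.\<close>

lemma quasisym_by_coeffs: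
  assumes "finite A" "A \<subseteq> compositions" "\<And>m. coeff f m = c (packed m)" "\<And>as. as \<notin> A \<Longrightarrow> c as = 0"
  shows "f \<in> Q.span (M_series ` compositions)"
proof -
  have co: "coeff (\<Sum>a\<in>B. c a *\<^sub>Q M_series a) m = (\<Sum>a\<in>B. c a * coeff (M_series a) m)" for B m
    by (induction B rule: infinite_finite_induct)
       (auto simp: zero_series.rep_eq plus_series.rep_eq scaleQ_series.rep_eq)
  have "f = (\<Sum>a\<in>A. c a *\<^sub>Q M_series a)"
  proof (rule series_eqI)
    fix m
    have "(\<Sum>a\<in>A. c a * coeff (M_series a) m) = (\<Sum>a\<in>A. if a = packed m then c a else 0)"
      using assms(2) by (intro sum.cong) (auto simp: coeff_M_series)
    also have "\<dots> = c (packed m)" using assms(1,4) by auto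
    finally show "coeff f m = coeff (\<Sum>a\<in>A. c a *\<^sub>Q M_series a) m" by (simp add: co assms(3))
  qed
  also have "\<dots> \<in> Q.span (M_series ` compositions)"
    by (rule Q.span_sum, rule Q.span_scale, rule Q.span_base) (use assms(2) in auto)
  finally show ?thesis .
qed

lemma sorted_list_of_subset:
  assumes "finite B" "A \<subseteq> B"
  shows "sorted_list_of_set A = filter (\<lambda>x. x \<in> A) (sorted_list_of_set (B::nat set))"
  using assms finite_subset[OF assms(2,1)]
  by (intro sorted_distinct_set_unique) (auto intro: sorted_wrt_filter distinct_filter)

lemma packed_filter:
  fixes p :: "nat \<Rightarrow>\<^sub>0 'e::zero"
  assumes "finite B" "Poly_Mapping.keys p \<subseteq> B"
  shows "packed p = filter (\<lambda>e. e \<noteq> 0) (map (Poly_Mapping.lookup p) (sorted_list_of_set B))"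
  unfolding packed_def sorted_list_of_subset[OF assms]
  by (simp add: filter_map comp_def in_keys_iff)

definition list_decomps :: "'e::plus list \<Rightarrow> ('e list \<times> 'e list) set" where
  "list_decomps as = {(u, v). length u = length as \<and> length v = length as \<and> map2 (+) u v = as}"

lemma sum_decompositions:
  fixes m :: "nat \<Rightarrow>\<^sub>0 'e::exponent"
  shows "(\<Sum>(p, q)\<in>{(p, q). p + q = m}. F (packed p) (packed q)) =
    (\<Sum>(u, v)\<in>list_decomps (packed m). F (filter (\<lambda>e. e \<noteq> 0) u) (filter (\<lambda>e. e \<noteq> 0) v))"
proof -
  let ?L = "sorted_list_of_set (Poly_Mapping.keys m)"
  let ?i = "\<lambda>(p, q). (map (Poly_Mapping.lookup p) ?L, map (Poly_Mapping.lookup q) ?L)"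
  let ?j = "\<lambda>(u, v). (monomial_at ?L u, monomial_at ?L v)"
  have keysL: "Poly_Mapping.keys (monomial_at ?L u) \<subseteq> Poly_Mapping.keys m"
    if "length u = length ?L" for u :: "'e list"
  proof
    fix k assume "k \<in> Poly_Mapping.keys (monomial_at ?L u)"
    hence "(\<Sum>j<length u. if ?L ! j = k then u ! j else 0) \<noteq> 0"
      using that by (simp add: in_keys_iff lookup_monomial_at)
    from sum_if_nonzeroD[OF this] obtain j where "j < length u" "?L ! j = k"
      by blast
    thus "k \<in> Poly_Mapping.keys m" using that
      by (metis finite_keys nth_mem set_sorted_list_of_set)
  qed
  have look: "map (Poly_Mapping.lookup (monomial_at ?L u)) ?L = u"
    if "length u = length ?L" for u :: "'e list"
    using that by (intro nth_equalityI) (auto simp: lookup_monomial_at_nth)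
  have eqI: "r = s"
    if "Poly_Mapping.keys r \<subseteq> Poly_Mapping.keys m" "Poly_Mapping.keys s \<subseteq> Poly_Mapping.keys m"
      "map (Poly_Mapping.lookup r) ?L = map (Poly_Mapping.lookup s) ?L"
    for r s :: "nat \<Rightarrow>\<^sub>0 'e"
  proof (rule poly_mapping_eqI)
    fix k
    show "Poly_Mapping.lookup r k = Poly_Mapping.lookup s k"
    proof (cases "k \<in> Poly_Mapping.keys m")
      case True
      thus ?thesis using that(3) by simp
    next
      case False
      hence "k \<notin> Poly_Mapping.keys r" "k \<notin> Poly_Mapping.keys s" using that by blast+
      thus ?thesis by (simp add: in_keys_iff)
    qed
  qed
  show ?thesis
  proof (rule sum.reindex_bij_witness[where i = ?j and j = ?i])
    fix x assume "x \<in> {(p, q). p + q = m}"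
    then obtain p q where x: "x = (p, q)" and m: "p + q = m" by auto
    have kp: "Poly_Mapping.keys p \<subseteq> Poly_Mapping.keys m"
      and kq: "Poly_Mapping.keys q \<subseteq> Poly_Mapping.keys m"
      unfolding m[symmetric] keys_add_exponent by auto
    show "?j (?i x) = x"
      unfolding x using kp kq by (auto intro!: eqI keysL look)
    show "?i x \<in> list_decomps (packed m)"
      unfolding x list_decomps_def packed_def
      by (auto simp: m[symmetric] lookup_add map2_map_map intro!: nth_equalityI)
    show "(case ?i x of (u, v) \<Rightarrow> F (filter (\<lambda>e. e \<noteq> 0) u) (filter (\<lambda>e. e \<noteq> 0) v)) =
        (case x of (p, q) \<Rightarrow> F (packed p) (packed q))"
      unfolding x using kp kq by (simp add: packed_filter[OF finite_keys[of m]])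
  next
    fix y assume "y \<in> list_decomps (packed m)"
    then obtain u v where y: "y = (u, v)" and len: "length u = length ?L" "length v = length ?L"
      and uv: "map2 (+) u v = packed m"
      by (auto simp: list_decomps_def packed_def)
    show "?i (?j y) = y" unfolding y using len by (simp add: look)
    have "monomial_at ?L u + monomial_at ?L v = m"
    proof (rule eqI)
      show "Poly_Mapping.keys (monomial_at ?L u + monomial_at ?L v) \<subseteq> Poly_Mapping.keys m"
        using len by (simp add: keys_add_exponent keysL)
      have "map (Poly_Mapping.lookup (monomial_at ?L u + monomial_at ?L v)) ?L =
          map2 (+) (map (Poly_Mapping.lookup (monomial_at ?L u)) ?L)
            (map (Poly_Mapping.lookup (monomial_at ?L v)) ?L)"
        by (simp add: lookup_add map2_map_map)
      also have "\<dots> = packed m" using len by (simp add: look uv)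
      finally show "map (Poly_Mapping.lookup (monomial_at ?L u + monomial_at ?L v)) ?L =
          map (Poly_Mapping.lookup m) ?L"
        by (simp add: packed_def)
    qed auto
    thus "?j y \<in> {(p, q). p + q = m}" by (simp add: y)
  qed
qed

lemma length_decomp_le:
  fixes u v :: "'e::exponent list"
  assumes "length u = length v" "map2 (+) u v \<in> compositions"
  shows "length u \<le> length (filter (\<lambda>e. e \<noteq> 0) u) + length (filter (\<lambda>e. e \<noteq> 0) v)"
  using assms
  by (induction u v rule: list_induct2) (auto simp: compositions_def)

lemma M_series_mult_closed:
  assumes "a \<in> compositions" "b \<in> compositions"
  shows "M_series a * M_series b \<in> Q.span (M_series ` compositions)"
proof -
  define F where "F = (\<lambda>x y. (if x = a then 1 else 0) * (if y = b then 1 else 0 :: rat))"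
  define c where "c = (\<lambda>w. \<Sum>(u, v)\<in>list_decomps w.
      F (filter (\<lambda>e. e \<noteq> 0) u) (filter (\<lambda>e. e \<noteq> 0) v))"
  define E where "E = case_prod (+) ` (insert 0 (set a) \<times> insert 0 (set b))"
  define A where "A = {w. set w \<subseteq> E \<and> length w \<le> length a + length b} \<inter> compositions"
  show ?thesis
  proof (rule quasisym_by_coeffs)
    show "finite A" unfolding A_def
      by (intro finite_Int disjI1 finite_lists_length_le) (simp add: E_def)
    show "A \<subseteq> compositions" by (simp add: A_def)
    fix m
    have "coeff (M_series a * M_series b) m =
        (\<Sum>(p, q)\<in>{(p, q). p + q = m}. F (packed p) (packed q))"
      using assms by (simp add: times_series.rep_eq coeff_M_series F_def)
    thus "coeff (M_series a * M_series b) m =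
        (if packed m \<in> compositions then c (packed m) else 0)"
      by (simp add: sum_decompositions c_def packed_composition)
  next
    fix w assume w: "w \<notin> A"
    show "(if w \<in> compositions then c w else 0) = 0"
    proof (cases "w \<in> compositions")
      case True
      have "F (filter (\<lambda>e. e \<noteq> 0) u) (filter (\<lambda>e. e \<noteq> 0) v) = 0"
        if uv: "(u, v) \<in> list_decomps w" for u v
      proof (rule ccontr)
        assume "F (filter (\<lambda>e. e \<noteq> 0) u) (filter (\<lambda>e. e \<noteq> 0) v) \<noteq> 0"
        hence fu: "filter (\<lambda>e. e \<noteq> 0) u = a" and fv: "filter (\<lambda>e. e \<noteq> 0) v = b"
          by (auto simp: F_def split: if_splits)
        have len: "length u = length w" "length v = length w" and w_eq: "w = map2 (+) u v"
          using uv by (auto simp: list_decomps_def)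
        have "set u \<subseteq> insert 0 (set a)" "set v \<subseteq> insert 0 (set b)"
          unfolding fu[symmetric] fv[symmetric] by auto
        hence "set w \<subseteq> E"
          unfolding w_eq E_def set_map
          by (intro image_mono) (auto dest: set_zip_leftD set_zip_rightD)
        moreover have "length w \<le> length a + length b"
          using length_decomp_le[OF trans[OF len(1) len(2)[symmetric]] True[unfolded w_eq]]
          unfolding fu fv len(1) .
        ultimately show False using w True by (simp add: A_def)
      qed
      thus ?thesis by (auto simp: c_def intro!: sum.neutral)
    qed auto
  qed
qed

lemma span_mult_closed:
  assumes "f \<in> Q.span (M_series ` compositions)" "g \<in> Q.span (M_series ` compositions)"
  shows "f * g \<in> Q.span (M_series ` compositions)"
proof -
  have b: "qlinear (\<lambda>g. f * g)" "qlinear (\<lambda>f. f * g)" for f g :: "(nat \<Rightarrow>\<^sub>0 'a) series"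
    using series_mult_bilinear by (auto simp: qbilinear_def)
  have 1: "M_series a * g \<in> Q.span (M_series ` compositions)" if a: "a \<in> compositions" for a :: "'a list"
    using assms(2)
  proof (induction rule: Q.span_induct_alt)
    case (step c x y)
    thus ?case
      by (auto simp: qlinear_add[OF b(1)] qlinear_scale[OF b(1)]
          intro!: Q.span_add Q.span_scale M_series_mult_closed a)
  qed (simp add: qlinear_zero[OF b(1)] Q.span_zero)
  show ?thesis
    using assms(1)
  proof (induction rule: Q.span_induct_alt)
    case (step c x y)
    thus ?case
      by (auto simp: qlinear_add[OF b(2)] qlinear_scale[OF b(2)]
          intro!: Q.span_add Q.span_scale 1)
  qed (simp add: qlinear_zero[OF b(2)] Q.span_zero)
qed

typedef (overloaded) 'e quasisym = "Q.span (M_series ` (compositions :: 'e::exponent list set))"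
  morphisms series_of Abs_quasisym
  using Q.span_zero by blast

setup_lifting type_definition_quasisym

type_synonym dqsym = "(nat \<times> nat) quasisym"
type_synonym qsym = "nat quasisym"

instantiation quasisym :: (exponent) rat_vector
begin
lift_definition zero_quasisym :: "'a quasisym" is 0 by (rule Q.span_zero)
lift_definition plus_quasisym :: "'a quasisym \<Rightarrow> 'a quasisym \<Rightarrow> 'a quasisym" is "(+)"
  by (rule Q.span_add)
lift_definition minus_quasisym :: "'a quasisym \<Rightarrow> 'a quasisym \<Rightarrow> 'a quasisym" is "(-)"
  by (rule Q.span_diff)
lift_definition uminus_quasisym :: "'a quasisym \<Rightarrow> 'a quasisym" is uminus
  by (rule Q.span_neg)
lift_definition scaleQ_quasisym :: "rat \<Rightarrow> 'a quasisym \<Rightarrow> 'a quasisym" is scaleQ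
  by (rule Q.span_scale)
instance
  by standard
    (transfer; simp add: algebra_simps scaleQ_add_right scaleQ_add_left scaleQ_one)+
end

instantiation quasisym :: (exponent) "{one, times}"
begin
lift_definition one_quasisym :: "'a quasisym" is 1
  unfolding M_series_Nil[symmetric] by (rule Q.span_base) (simp add: compositions_def)
lift_definition times_quasisym :: "'a quasisym \<Rightarrow> 'a quasisym \<Rightarrow> 'a quasisym" is "(*)"
  by (rule span_mult_closed)
instance ..
end

text \<open>The basis element \<open>M_basis as\<close>, meaningful for \<open>as \<in> compositions\<close> only.\<close>

lift_definition M_basis :: "'e::exponent list \<Rightarrow> 'e quasisym"
  is "\<lambda>as. if as \<in> compositions then M_series as else 0"
  by (auto intro: Q.span_base Q.span_zero)

lemma series_of_M: "as \<in> compositions \<Longrightarrow> series_of (M_basis as) = M_series as"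
  by (simp add: M_basis.rep_eq)

lemma series_of_linear: "qlinear series_of"
  by (simp add: qlinear_iff plus_quasisym.rep_eq scaleQ_quasisym.rep_eq)

lemma span_M: "Q.span (M_basis ` compositions) = (UNIV :: 'e::exponent quasisym set)"
proof -
  have "series_of ` M_basis ` (compositions :: 'e list set) = M_series ` compositions"
    unfolding image_image by (intro image_cong refl) (simp add: series_of_M)
  hence eq: "series_of ` Q.span (M_basis ` (compositions :: 'e list set)) = Q.span (M_series ` compositions)"
    using QP.linear_span_image[OF series_of_linear, of "M_basis ` (compositions :: 'e list set)"] by simp
  have "f \<in> Q.span (M_basis ` compositions)" for f :: "'e quasisym"
  proof -
    have "series_of f \<in> series_of ` Q.span (M_basis ` compositions)"
      unfolding eq by (rule series_of)
    thus ?thesis by (auto simp: series_of_inject)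
  qed
  thus ?thesis by blast
qed

lemma coeff_M:
  "as \<in> compositions \<Longrightarrow> coeff (series_of (M_basis as)) m = (if packed m = as then 1 else 0)"
  by (simp add: series_of_M coeff_M_series)

lemma packed_surj:
  fixes as :: "'e::exponent list"
  assumes "as \<in> compositions" obtains m where "packed m = as"
  using packed_monomial_at(1)[of "[0..<length as]" as] assms by auto

lemma inj_on_M: "inj_on M_basis (compositions :: 'e::exponent list set)"
proof (rule inj_onI)
  fix a b :: "'e list"
  assume ab: "a \<in> compositions" "b \<in> compositions" "M_basis a = M_basis b"
  obtain m where "packed m = a" using ab(1) packed_surj by blast
  thus "a = b" using coeff_M[OF ab(1), of m] coeff_M[OF ab(2), of m] ab(3)
    by (auto split: if_splits)
qed

lemma coeff_sum_M:
  assumes "finite A" "A \<subseteq> compositions"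
  shows "coeff (series_of (\<Sum>a\<in>A. c a *\<^sub>Q M_basis a)) m = (if packed m \<in> A then c (packed m) else 0)"
proof -
  have "coeff (series_of (\<Sum>a\<in>A. c a *\<^sub>Q M_basis a)) m = (\<Sum>a\<in>A. c a * coeff (series_of (M_basis a)) m)"
    by (induction A rule: infinite_finite_induct)
       (auto simp: zero_quasisym.rep_eq plus_quasisym.rep_eq scaleQ_quasisym.rep_eq
          zero_series.rep_eq plus_series.rep_eq scaleQ_series.rep_eq)
  also have "\<dots> = (\<Sum>a\<in>A. if a = packed m then c a else 0)"
    using assms(2) by (intro sum.cong) (auto simp: coeff_M)
  finally show ?thesis using assms(1) by simp
qed

lemma independent_M: "\<not> Q.dependent (M_basis ` (compositions :: 'e::exponent list set))"
  unfolding Q.independent_explicit_module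
proof (intro allI impI)
  fix T u and v :: "'e quasisym"
  assume T: "finite T" "T \<subseteq> M_basis ` compositions" and 0: "(\<Sum>v\<in>T. u v *\<^sub>Q v) = 0" and v: "v \<in> T"
  obtain A where A: "A \<subseteq> compositions" "finite A" "T = M_basis ` A"
    using finite_subset_image[OF T] by blast
  obtain a where a: "a \<in> A" "v = M_basis a" using v A by blast
  obtain m where m: "packed m = a" using a A packed_surj by blast
  have "inj_on M_basis A" using inj_on_M A(1) by (rule inj_on_subset)
  hence "(\<Sum>a\<in>A. u (M_basis a) *\<^sub>Q M_basis a) = 0"
    using 0 unfolding A(3) by (simp add: sum.reindex)
  hence "coeff (series_of (\<Sum>a\<in>A. u (M_basis a) *\<^sub>Q M_basis a)) m = 0"
    by (simp add: zero_quasisym.rep_eq zero_series.rep_eq)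
  thus "u v = 0" using a by (simp add: coeff_sum_M[OF A(2,1)] m)
qed

text \<open>The linear map with prescribed values on the basis \<open>M_basis as\<close>, \<open>as \<in> compositions\<close>.\<close>

definition basis_extend :: "('e::exponent list \<Rightarrow> 'b::rat_vector) \<Rightarrow> 'e quasisym \<Rightarrow> 'b" where
  "basis_extend g = (THE h. qlinear h \<and> (\<forall>as\<in>compositions. h (M_basis as) = g as))"

lemma basis_extend_ex1:
  fixes g :: "'e::exponent list \<Rightarrow> 'b::rat_vector"
  shows "\<exists>!h. qlinear h \<and> (\<forall>as\<in>compositions. h (M_basis as) = g as)"
proof (rule ex_ex1I)
  let ?h = "QP.construct (M_basis ` compositions) (\<lambda>v. g (the_inv_into compositions M_basis v))"
  have "qlinear ?h" by (rule QP.linear_construct[OF independent_M])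
  moreover have "?h (M_basis as) = g as" if "as \<in> compositions" for as
    using that by (subst QP.construct_basis[OF independent_M])
      (auto simp: the_inv_into_f_f[OF inj_on_M])
  ultimately show "\<exists>h. qlinear h \<and> (\<forall>as\<in>compositions. h (M_basis as) = g as)" by blast
next
  fix h k :: "'e quasisym \<Rightarrow> 'b"
  assume h: "qlinear h \<and> (\<forall>as\<in>compositions. h (M_basis as) = g as)"
    and k: "qlinear k \<and> (\<forall>as\<in>compositions. k (M_basis as) = g as)"
  show "h = k"
  proof
    fix x :: "'e quasisym"
    have "x \<in> Q.span (M_basis ` compositions)" unfolding span_M by (rule UNIV_I)
    thus "h x = k x"
      by (rule qlinear_eq_on_span[rotated -1]) (use h k in auto)
  qed
qed

lemma basis_extend_linear: "qlinear (basis_extend g)"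
  and basis_extend_M: "as \<in> compositions \<Longrightarrow> basis_extend g (M_basis as) = g as"
  using theI'[OF basis_extend_ex1[of g]] by (auto simp: basis_extend_def)

definition comult :: "'e::exponent quasisym \<Rightarrow> 'e quasisym \<otimes> 'e quasisym" where
  "comult = basis_extend (\<lambda>as. \<Sum>(us, vs)\<in>{(us, vs). us @ vs = as}. M_basis us \<otimes>\<^sub>p M_basis vs)"

definition counit :: "'e::exponent quasisym \<Rightarrow> rat" where
  "counit = basis_extend (\<lambda>as. if as = [] then 1 else 0)"

lemma comult_linear: "qlinear comult" and counit_linear: "qlinear counit"
  by (simp_all add: comult_def counit_def basis_extend_linear)

lemma comult_M:
  "as \<in> compositions \<Longrightarrow>
    comult (M_basis as) = (\<Sum>(us, vs)\<in>{(us, vs). us @ vs = as}. M_basis us \<otimes>\<^sub>p M_basis vs)"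
  by (simp add: comult_def basis_extend_M)

lemma counit_M: "as \<in> compositions \<Longrightarrow> counit (M_basis as) = (if as = [] then 1 else 0)"
  by (simp add: counit_def basis_extend_M)

text \<open>
  The homogeneous components: the bidegree for \<open>'e = nat \<times> nat\<close>, the degree for \<open>'e = nat\<close>.
\<close>

definition degree_component :: "'e::exponent \<Rightarrow> 'e quasisym set" where
  "degree_component d = Q.span {M_basis as | as. as \<in> compositions \<and> sum_list as = d}"

definition total_degree_component :: "nat \<Rightarrow> dqsym set" where
  "total_degree_component n = Q.span (\<Union>(d1, d2)\<in>{(d1, d2). d1 + d2 = n}. degree_component (d1, d2))"

section \<open>Setting \<open>y = x\<close>\<close>

lift_definition set_y_eq_x_monomial :: "(nat \<Rightarrow>\<^sub>0 nat \<times> nat) \<Rightarrow> (nat \<Rightarrow>\<^sub>0 nat)"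
  is "\<lambda>m i. fst (m i) + snd (m i)"
  by (rule finite_subset[rotated], assumption) (auto simp: zero_prod_def)

lift_definition set_y_eq_x_series :: "(nat \<Rightarrow>\<^sub>0 nat \<times> nat) series \<Rightarrow> (nat \<Rightarrow>\<^sub>0 nat) series"
  is "\<lambda>f c. \<Sum>m\<in>{m. set_y_eq_x_monomial m = c}. f m" .

text \<open>The sum defining \<open>set_y_eq_x_series\<close> is finite.\<close>

lemma finite_set_y_eq_x_monomial: "finite {m. set_y_eq_x_monomial m = c}"
proof -
  let ?x = "\<lambda>m :: nat \<Rightarrow>\<^sub>0 nat \<times> nat. Poly_Mapping.map fst m"
  let ?y = "\<lambda>m :: nat \<Rightarrow>\<^sub>0 nat \<times> nat. Poly_Mapping.map snd m"
  have lk: "Poly_Mapping.lookup (?x m) i = fst (Poly_Mapping.lookup m i)"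
    "Poly_Mapping.lookup (?y m) i = snd (Poly_Mapping.lookup m i)" for m i
    by (simp_all add: map.rep_eq when_def zero_prod_def)
  have "(\<lambda>m. (?x m, ?y m)) ` {m. set_y_eq_x_monomial m = c} \<subseteq> {(p, q). p + q = c}"
    by (auto intro!: poly_mapping_eqI simp: lookup_add lk set_y_eq_x_monomial.rep_eq)
  moreover have "inj_on (\<lambda>m. (?x m, ?y m)) {m. set_y_eq_x_monomial m = c}"
    by (rule inj_onI) (metis lk poly_mapping_eqI prod.inject prod_eqI)
  ultimately show ?thesis
    using finite_decompositions[of c] by (meson finite_imageD finite_subset)
qed

lemma set_y_eq_x_series_linear: "qlinear set_y_eq_x_series"
  by (rule qlinearI; transfer; simp add: sum.distrib sum_distrib_left)

lemma keys_set_y_eq_x_monomial: "Poly_Mapping.keys (set_y_eq_x_monomial m) = Poly_Mapping.keys m"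
  by (auto simp: in_keys_iff set_y_eq_x_monomial.rep_eq prod_eq_iff)

lemma packed_set_y_eq_x_monomial:
  "packed (set_y_eq_x_monomial m) = map (\<lambda>(a, b). a + b) (packed m)"
  by (simp add: packed_def keys_set_y_eq_x_monomial set_y_eq_x_monomial.rep_eq split_beta)

lemma map_plus_compositions:
  "as \<in> compositions \<Longrightarrow> map (\<lambda>(a, b). a + b) as \<in> (compositions :: nat list set)"
  by (auto simp: compositions_def zero_prod_def)

lemma set_y_eq_x_M_series:
  assumes "as \<in> compositions"
  shows "set_y_eq_x_series (M_series as) = M_series (map (\<lambda>(a, b). a + b) as)"
proof (rule series_eqI)
  fix c :: "nat \<Rightarrow>\<^sub>0 nat"
  let ?m = "monomial_at (sorted_list_of_set (Poly_Mapping.keys c)) as"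
  let ?S = "{m. set_y_eq_x_monomial m = c}"
  have uniq: "m = ?m" if "m \<in> ?S" "packed m = as" for m
    using monomial_at_packed[of m] that keys_set_y_eq_x_monomial[of m] by simp
  show "coeff (set_y_eq_x_series (M_series as)) c = coeff (M_series (map (\<lambda>(a, b). a + b) as)) c"
  proof (cases "packed c = map (\<lambda>(a, b). a + b) as")
    case True
    have len: "length (sorted_list_of_set (Poly_Mapping.keys c)) = length as"
      using arg_cong[OF True, of length] unfolding packed_def length_map .
    have p: "packed ?m = as" "sorted_list_of_set (Poly_Mapping.keys ?m) =
        sorted_list_of_set (Poly_Mapping.keys c)"
      by (rule packed_monomial_at[OF len _ assms]; simp)+
    have "set_y_eq_x_monomial ?m =
        monomial_at (sorted_list_of_set (Poly_Mapping.keys c)) (packed c)"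
      using monomial_at_packed[of "set_y_eq_x_monomial ?m"]
      by (simp add: packed_set_y_eq_x_monomial keys_set_y_eq_x_monomial p True)
    hence mS: "?m \<in> ?S" by (simp add: monomial_at_packed)
    have "(\<Sum>m\<in>?S. if packed m = as then 1 else 0 :: rat) = (\<Sum>m\<in>?S. if m = ?m then 1 else 0)"
    proof (rule sum.cong[OF refl])
      fix m assume "m \<in> ?S"
      hence "packed m = as \<longleftrightarrow> m = ?m" using uniq[of m] p(1) by metis
      thus "(if packed m = as then 1 else 0 :: rat) = (if m = ?m then 1 else 0)" by (simp only:)
    qed
    also have "\<dots> = 1" using mS finite_set_y_eq_x_monomial[of c] by simp
    finally show ?thesis
      using True assms
      by (simp add: set_y_eq_x_series.rep_eq coeff_M_series map_plus_compositions)
  next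
    case False
    hence "packed m \<noteq> as" if "m \<in> ?S" for m
      using that packed_set_y_eq_x_monomial[of m] by auto
    thus ?thesis
      using False assms
      by (simp add: set_y_eq_x_series.rep_eq coeff_M_series map_plus_compositions)
  qed
qed

lift_definition set_y_eq_x :: "dqsym \<Rightarrow> qsym" is set_y_eq_x_series
proof -
  fix f :: "(nat \<Rightarrow>\<^sub>0 nat \<times> nat) series"
  assume "f \<in> Q.span (M_series ` compositions)"
  thus "set_y_eq_x_series f \<in> Q.span (M_series ` compositions)"
  proof (induction rule: Q.span_induct_alt)
    case base
    show ?case by (simp add: qlinear_zero[OF set_y_eq_x_series_linear] Q.span_zero)
  next
    case (step c x y)
    then obtain as where as: "as \<in> compositions" "x = M_series as" by blast
    have "set_y_eq_x_series x \<in> M_series ` compositions"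
      using as map_plus_compositions by (auto simp: set_y_eq_x_M_series)
    hence "set_y_eq_x_series x \<in> Q.span (M_series ` compositions)" by (rule Q.span_base)
    thus ?case using step(2)
      by (simp add: qlinear_add[OF set_y_eq_x_series_linear]
          qlinear_scale[OF set_y_eq_x_series_linear] Q.span_add Q.span_scale)
  qed
qed

lemma set_y_eq_x_M:
  "as \<in> compositions \<Longrightarrow> set_y_eq_x (M_basis as) = M_basis (map (\<lambda>(a, b). a + b) as)"
  by (simp add: series_of_inject[symmetric] set_y_eq_x.rep_eq series_of_M set_y_eq_x_M_series
      map_plus_compositions)

end

theory Submission
  imports Defs
begin

text \<open>
  The Hopf algebra structure is established for exponents in an arbitrary \<open>'e :: exponent\<close>, so that \<open>dqsym\<close> and \<open>qsym\<close> are treated together.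

  Multiplication of series is associative and commutative, which makes \<open>'e quasisym\<close> a commutative
  ring. On the basis, \<open>M_basis as * M_basis bs\<close> is the sum over all quasi-shuffles \<open>zs\<close> of \<open>as\<close> and
  \<open>bs\<close> of the basis element obtained by adding the two entries of each pair in \<open>zs\<close>
  (\<open>M_basis_mult\<close>). Since a quasi-shuffle of \<open>as\<close> and \<open>bs\<close> together with a cut is the same as a cut
  of \<open>as\<close>, a cut of \<open>bs\<close> and quasi-shuffles of the two left and of the two right parts
  (\<open>sum_splits_quasi_shuffles\<close>), deconcatenation is multiplicative.

  An antipode is a two-sided inverse of \<open>M_basis\<close> for the convolution of functions on lists. Every
  \<open>f\<close> with \<open>f [] = 1\<close> has a left inverse, given by recursion on the length; that left inverse again
  has a left inverse, so it is two-sided. The same recursion (\<open>antipode_M_basis\<close>) determines every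
  antipode on the basis, so by induction on the length antipodes preserve degrees and commute with
  \<open>set_y_eq_x\<close>.

  The bigrading and the two gradings by degree are instances of one grading: the basis element of
  \<open>as\<close> is put in degree \<open>\<phi> (sum_list as)\<close> for an additive map \<open>\<phi>\<close> on exponents
  (\<open>graded_hopf_algebra_quasisym\<close>). Finally, \<open>set_y_eq_x\<close> is multiplicative because it is a
  substitution in formal series, and compatible with deconcatenation because it adds entries of a
  list one position at a time.
\<close>

section \<open>The algebra of formal series\<close>

lemma series_mult_assoc: "(f * g) * h = f * (g * h)" for f g h :: "'m::exponent series"
proof (rule series_eqI)
  fix m
  let ?D = "\<lambda>m::'m. {(p, q). p + q = m}"
  have fin: "finite (?D m)" for m :: 'm by (rule finite_decompositions)
  have "coeff ((f * g) * h) m =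
      (\<Sum>x\<in>?D m. \<Sum>y\<in>?D (fst x). coeff f (fst y) * coeff g (snd y) * coeff h (snd x))"
    by (simp add: times_series.rep_eq split_beta sum_distrib_right)
  also have "\<dots> = (\<Sum>(x, y)\<in>Sigma (?D m) (\<lambda>x. ?D (fst x)).
      coeff f (fst y) * coeff g (snd y) * coeff h (snd x))"
    using fin by (intro sum.Sigma) blast+
  also have "\<dots> = (\<Sum>(x, y)\<in>Sigma (?D m) (\<lambda>x. ?D (snd x)).
      coeff f (fst x) * (coeff g (fst y) * coeff h (snd y)))"
    by (rule sum.reindex_bij_witness[where i = "\<lambda>((p, s), (q, r)). ((p + q, r), (p, q))"
          and j = "\<lambda>((s, r), (p, q)). ((p, q + r), (q, r))"]) (auto simp: add.assoc mult.assoc)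
  also have "\<dots> = (\<Sum>x\<in>?D m. \<Sum>y\<in>?D (snd x).
      coeff f (fst x) * (coeff g (fst y) * coeff h (snd y)))"
    using fin by (intro sum.Sigma[symmetric]) blast+
  also have "\<dots> = coeff (f * (g * h)) m"
    by (simp add: times_series.rep_eq split_beta sum_distrib_left)
  finally show "coeff ((f * g) * h) m = coeff (f * (g * h)) m" .
qed

lemma series_mult_commute: "f * g = g * f" for f g :: "'m::exponent series"
proof (rule series_eqI)
  fix m
  show "coeff (f * g) m = coeff (g * f) m"
    unfolding times_series.rep_eq
    by (rule sum.reindex_bij_witness[where i = prod.swap and j = prod.swap])
       (auto simp: add.commute mult.commute)
qed

lemma series_mult_1_left: "1 * f = f" for f :: "'m::exponent series"
proof (rule series_eqI)
  fix m
  have "coeff (1 * f) m = (\<Sum>(p, q)\<in>{(p, q). p + q = m}. if p = 0 then coeff f q else 0)"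
    unfolding times_series.rep_eq by (intro sum.cong) (auto simp: one_series.rep_eq)
  also have "\<dots> = (\<Sum>(p, q)\<in>{(0 :: 'm, m)}. if p = 0 then coeff f q else 0)"
  proof (rule sum.mono_neutral_right[OF finite_decompositions])
    show "{(0, m)} \<subseteq> {(p, q). p + q = m}" by simp
  qed (auto split: if_splits)
  finally show "coeff (1 * f) m = coeff f m" by simp
qed

instance quasisym :: (exponent) comm_ring_1
proof
  fix f g h :: "'a quasisym"
  have lin: "qlinear (\<lambda>x. x * y)" for y :: "(nat \<Rightarrow>\<^sub>0 'a) series"
    using series_mult_bilinear by (auto simp: qbilinear_def)
  show "f * g * h = f * (g * h)" by transfer (rule series_mult_assoc)
  show "f * g = g * f" by transfer (rule series_mult_commute)
  show "1 * f = f" by transfer (rule series_mult_1_left)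
  show "(f + g) * h = f * h + g * h" by transfer (rule qlinear_add[OF lin])
  have "coeff (series_of (1 :: 'a quasisym)) 0 \<noteq> coeff (series_of 0) 0"
    by (simp add: one_quasisym.rep_eq zero_quasisym.rep_eq one_series.rep_eq zero_series.rep_eq)
  thus "(0 :: 'a quasisym) \<noteq> 1" by metis
qed

lemma quasisym_scale_mult: "(c *\<^sub>Q f) * g = c *\<^sub>Q (f * g)" for f g :: "'e::exponent quasisym"
proof transfer
  fix c and f g :: "(nat \<Rightarrow>\<^sub>0 'e) series"
  have "qlinear (\<lambda>x. x * g)" using series_mult_bilinear by (auto simp: qbilinear_def)
  thus "(c *\<^sub>Q f) * g = c *\<^sub>Q (f * g)" by (rule qlinear_scale)
qed

lemma quasisym_mult_linear_left: "qlinear (\<lambda>f. f * g)" for g :: "'e::exponent quasisym"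
  by (intro qlinearI) (simp_all add: distrib_right quasisym_scale_mult)

lemma quasisym_mult_linear_right: "qlinear (\<lambda>g. f * g)" for f :: "'e::exponent quasisym"
  using quasisym_mult_linear_left[of f] by (simp add: mult.commute)

lemma quasisym_mult_bilinear: "qbilinear ((*) :: 'e::exponent quasisym \<Rightarrow> _)"
  by (simp add: qbilinear_def quasisym_mult_linear_left quasisym_mult_linear_right)

lemma M_basis_Nil: "M_basis [] = (1 :: 'e::exponent quasisym)"
  by transfer (simp add: M_series_Nil compositions_def)

lemma quasisym_eqI:
  fixes f g :: "'e::exponent quasisym \<Rightarrow> 'b::rat_vector"
  assumes "qlinear f" "qlinear g" "\<And>as. as \<in> compositions \<Longrightarrow> f (M_basis as) = g (M_basis as)"
  shows "f x = g x"
proof (rule qlinear_eq_on_span[OF assms(1,2)])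
  show "x \<in> Q.span (M_basis ` compositions)" unfolding span_M by (rule UNIV_I)
qed (auto simp: assms(3))

lemma quasisym_bilinear_eqI:
  fixes f g :: "'e::exponent quasisym \<Rightarrow> 'd::exponent quasisym \<Rightarrow> 'b::rat_vector"
  assumes "\<And>x. qlinear (f x)" "\<And>y. qlinear (\<lambda>x. f x y)"
    and "\<And>x. qlinear (g x)" "\<And>y. qlinear (\<lambda>x. g x y)"
    and "\<And>as bs. as \<in> compositions \<Longrightarrow> bs \<in> compositions \<Longrightarrow>
      f (M_basis as) (M_basis bs) = g (M_basis as) (M_basis bs)"
  shows "f x y = g x y"
  by (rule quasisym_eqI[OF assms(2,4)], rule quasisym_eqI[OF assms(1,3)], rule assms(5))

section \<open>Deconcatenation\<close>

text \<open>The ways to write a list as a concatenation, empty factors included.\<close>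

definition splits :: "'a list \<Rightarrow> ('a list \<times> 'a list) set" where
  "splits as = {(us, vs). us @ vs = as}"

lemma splits_eq: "splits as = (\<lambda>i. (take i as, drop i as)) ` {..length as}"
proof
  show "splits as \<subseteq> (\<lambda>i. (take i as, drop i as)) ` {..length as}"
  proof
    fix x assume "x \<in> splits as"
    then obtain us vs where "x = (us, vs)" "us @ vs = as" by (auto simp: splits_def)
    thus "x \<in> (\<lambda>i. (take i as, drop i as)) ` {..length as}"
      by (intro image_eqI[of _ _ "length us"]) auto
  qed
qed (auto simp: splits_def)

lemma finite_splits: "finite (splits as)"
  by (simp add: splits_eq)

lemma sum_splits:
  "(\<Sum>(us, vs)\<in>splits as. F us vs) = F as [] + (\<Sum>i<length as. F (take i as) (drop i as))"
proof -
  have "inj_on (\<lambda>i. (take i as, drop i as)) {..length as}"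
    by (rule inj_onI) (metis atMost_iff length_take min.absorb2 prod.inject)
  hence "(\<Sum>(us, vs)\<in>splits as. F us vs) = (\<Sum>i\<le>length as. F (take i as) (drop i as))"
    by (simp add: splits_eq sum.reindex)
  thus ?thesis by (simp add: lessThan_Suc_atMost[symmetric] add.commute)
qed

text \<open>
  Cutting a list in three, in either order. This yields both coassociativity and the associativity
  of convolution.
\<close>

lemma sum_splits_assoc:
  "(\<Sum>(us, cs)\<in>splits ws. \<Sum>(as, bs)\<in>splits us. F as bs cs) =
   (\<Sum>(as, us)\<in>splits ws. \<Sum>(bs, cs)\<in>splits us. F as bs cs)"
proof -
  have "(\<Sum>(us, cs)\<in>splits ws. \<Sum>(as, bs)\<in>splits us. F as bs cs) =
      (\<Sum>(x, y)\<in>Sigma (splits ws) (\<lambda>x. splits (fst x)). F (fst y) (snd y) (snd x))"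
    unfolding split_beta by (subst sum.Sigma) (auto simp: finite_splits split_beta)
  also have "\<dots> = (\<Sum>(x, y)\<in>Sigma (splits ws) (\<lambda>x. splits (snd x)). F (fst x) (fst y) (snd y))"
    by (rule sum.reindex_bij_witness[where i = "\<lambda>((as, us), (bs, cs)). ((as @ bs, cs), (as, bs))"
          and j = "\<lambda>((us, cs), (as, bs)). ((as, bs @ cs), (bs, cs))"]) (auto simp: splits_def)
  also have "\<dots> = (\<Sum>(as, us)\<in>splits ws. \<Sum>(bs, cs)\<in>splits us. F as bs cs)"
    unfolding split_beta by (subst sum.Sigma) (auto simp: finite_splits split_beta)
  finally show ?thesis .
qed

lemma sum_splits_map:
  "(\<Sum>(us, vs)\<in>splits (map h as). F us vs) = (\<Sum>(us, vs)\<in>splits as. F (map h us) (map h vs))"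
  by (simp add: sum_splits take_map drop_map)

lemma sum_splits_Nil_left:
  fixes as :: "'a list"
  shows "(\<Sum>(us, vs)\<in>splits as. if us = [] then F vs else 0) = F as"
proof -
  have "(\<Sum>(us, vs)\<in>splits as. if us = [] then F vs else 0) =
      (\<Sum>(us, vs)\<in>{([] :: 'a list, as)}. if us = [] then F vs else 0)"
    by (rule sum.mono_neutral_right[OF finite_splits]) (auto simp: splits_def split: if_splits)
  thus ?thesis by simp
qed

lemma sum_splits_Nil_right:
  fixes as :: "'a list"
  shows "(\<Sum>(us, vs)\<in>splits as. if vs = [] then F us else 0) = F as"
proof -
  have "(\<Sum>(us, vs)\<in>splits as. if vs = [] then F us else 0) =
      (\<Sum>(us, vs)\<in>{(as, [] :: 'a list)}. if vs = [] then F us else 0)"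
    by (rule sum.mono_neutral_right[OF finite_splits]) (auto simp: splits_def split: if_splits)
  thus ?thesis by simp
qed

lemma splits_compositions:
  "as \<in> compositions \<Longrightarrow> (us, vs) \<in> splits as \<Longrightarrow> us \<in> compositions \<and> vs \<in> compositions"
  by (auto simp: splits_def compositions_def)

lemma comult_splits:
  "as \<in> compositions \<Longrightarrow> comult (M_basis as) = (\<Sum>(us, vs)\<in>splits as. M_basis us \<otimes>\<^sub>p M_basis vs)"
  by (simp add: comult_M splits_def)

lemma linear_comult_M:
  fixes h :: "'e::exponent quasisym \<otimes> 'e quasisym \<Rightarrow> 'b::rat_vector"
  assumes "qlinear h" "as \<in> compositions"
  shows "h (comult (M_basis as)) = (\<Sum>(us, vs)\<in>splits as. h (M_basis us \<otimes>\<^sub>p M_basis vs))"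
  by (simp add: comult_splits[OF assms(2)] qlinear_sum[OF assms(1)] split_beta)

lemma qlinear_id: "qlinear id" by (rule qlinearI) auto

lemma quasisym_coassoc:
  fixes x :: "'e::exponent quasisym"
  shows "tensor_assoc (tensor_map comult id (comult x)) = tensor_map id comult (comult x)"
proof (rule quasisym_eqI)
  note lin = comult_linear tensor_map_linear[OF comult_linear qlinear_id]
    tensor_map_linear[OF qlinear_id comult_linear] tensor_assoc_linear
  show "qlinear (\<lambda>x :: 'e quasisym. tensor_assoc (tensor_map comult id (comult x)))"
    by (intro qlinear_compose[OF _ tensor_assoc_linear] qlinear_compose[OF lin(1,2)])
  show "qlinear (\<lambda>x :: 'e quasisym. tensor_map id comult (comult x))"
    by (rule qlinear_compose[OF lin(1,3)])
  fix ws :: "'e list" assume ws: "ws \<in> compositions"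
  have "tensor_assoc (tensor_map comult id (comult (M_basis ws))) =
      (\<Sum>(us, cs)\<in>splits ws. tensor_assoc (comult (M_basis us) \<otimes>\<^sub>p M_basis cs))"
    using linear_comult_M[OF qlinear_compose[OF lin(2,4)] ws]
    by (simp add: tensor_map_pure comult_linear qlinear_id)
  also have "\<dots> = (\<Sum>(us, cs)\<in>splits ws. \<Sum>(as, bs)\<in>splits us.
      M_basis as \<otimes>\<^sub>p M_basis bs \<otimes>\<^sub>p M_basis cs)"
  proof (intro sum.cong refl, clarify)
    fix us cs assume "(us, cs) \<in> splits ws"
    hence us: "us \<in> compositions" using splits_compositions ws by blast
    show "tensor_assoc (comult (M_basis us) \<otimes>\<^sub>p M_basis cs) =
        (\<Sum>(as, bs)\<in>splits us. M_basis as \<otimes>\<^sub>p M_basis bs \<otimes>\<^sub>p M_basis cs)"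
      using linear_comult_M[OF qlinear_compose[OF pure_tensor_linear_left tensor_assoc_linear] us]
      by (simp add: tensor_assoc_pure)
  qed
  also have "\<dots> = (\<Sum>(as, us)\<in>splits ws. \<Sum>(bs, cs)\<in>splits us.
      M_basis as \<otimes>\<^sub>p M_basis bs \<otimes>\<^sub>p M_basis cs)"
    by (rule sum_splits_assoc)
  also have "\<dots> = (\<Sum>(as, us)\<in>splits ws. M_basis as \<otimes>\<^sub>p comult (M_basis us))"
  proof (intro sum.cong refl, clarify)
    fix as us assume "(as, us) \<in> splits ws"
    hence us: "us \<in> compositions" using splits_compositions ws by blast
    show "(\<Sum>(bs, cs)\<in>splits us. M_basis as \<otimes>\<^sub>p M_basis bs \<otimes>\<^sub>p M_basis cs) =
        M_basis as \<otimes>\<^sub>p comult (M_basis us)"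
      by (rule linear_comult_M[OF pure_tensor_linear_right us, symmetric])
  qed
  also have "\<dots> = tensor_map id comult (comult (M_basis ws))"
    using linear_comult_M[OF lin(3) ws]
    by (simp add: tensor_map_pure comult_linear qlinear_id)
  finally show "tensor_assoc (tensor_map comult id (comult (M_basis ws))) =
      tensor_map id comult (comult (M_basis ws))" .
qed

lemma counit_bilinear:
  "qbilinear (\<lambda>(a :: 'e::exponent quasisym) (b :: 'b::rat_vector). counit a *\<^sub>Q b)" (is ?L)
  "qbilinear (\<lambda>(a :: 'b::rat_vector) (b :: 'e::exponent quasisym). counit b *\<^sub>Q a)" (is ?R)
proof -
  have "qlinear (\<lambda>b :: 'b. c *\<^sub>Q b)" "qlinear (\<lambda>x :: 'e quasisym. counit x *\<^sub>Q v)" for c and v :: 'b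
    by (auto intro!: qlinearI simp: qlinear_add[OF counit_linear] qlinear_scale[OF counit_linear]
        scaleQ_add_right scaleQ_add_left scaleQ_scaleQ scaleQ_rat_def mult.commute)
  thus ?L ?R by (simp_all add: qbilinear_def)
qed

lemma quasisym_coalgebra: "rat_coalgebra comult (counit :: 'e::exponent quasisym \<Rightarrow> rat)"
proof (rule rat_coalgebra.intro)
  fix x :: "'e quasisym"
  show "tensor_assoc (tensor_map comult id (comult x)) = tensor_map id comult (comult x)"
    by (rule quasisym_coassoc)
  note L = counit_bilinear(1)[where 'b = "'e quasisym" and 'e = 'e]
  note R = counit_bilinear(2)[where 'b = "'e quasisym" and 'e = 'e]
  show "tensor_lift (\<lambda>a b. counit a *\<^sub>Q b) (comult x) = x"
  proof (rule quasisym_eqI)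
    show "qlinear (\<lambda>x :: 'e quasisym. tensor_lift (\<lambda>a b. counit a *\<^sub>Q b) (comult x))"
      by (rule qlinear_compose[OF comult_linear tensor_lift_linear[OF L]])
    fix as :: "'e list" assume as: "as \<in> compositions"
    have "tensor_lift (\<lambda>a b. counit a *\<^sub>Q b) (comult (M_basis as)) =
        (\<Sum>(us, vs)\<in>splits as. counit (M_basis us) *\<^sub>Q M_basis vs)"
      by (simp add: linear_comult_M[OF tensor_lift_linear[OF L] as] tensor_lift_pure[OF L])
    also have "\<dots> = (\<Sum>(us, vs)\<in>splits as. if us = [] then M_basis vs else 0)"
    proof (intro sum.cong refl, clarify)
      fix us vs assume uv: "(us, vs) \<in> splits as"
      hence "us \<in> compositions" using splits_compositions as by blast
      thus "counit (M_basis us) *\<^sub>Q M_basis vs = (if us = [] then M_basis vs else 0)"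
        using uv by (auto simp: counit_M scaleQ_one splits_def)
    qed
    also have "\<dots> = M_basis as" by (rule sum_splits_Nil_left)
    finally show "tensor_lift (\<lambda>a b. counit a *\<^sub>Q b) (comult (M_basis as)) = M_basis as" .
  qed (rule qlinearI; simp)
  show "tensor_lift (\<lambda>a b. counit b *\<^sub>Q a) (comult x) = x"
  proof (rule quasisym_eqI)
    show "qlinear (\<lambda>x :: 'e quasisym. tensor_lift (\<lambda>a b. counit b *\<^sub>Q a) (comult x))"
      by (rule qlinear_compose[OF comult_linear tensor_lift_linear[OF R]])
    fix as :: "'e list" assume as: "as \<in> compositions"
    have "tensor_lift (\<lambda>a b. counit b *\<^sub>Q a) (comult (M_basis as)) =
        (\<Sum>(us, vs)\<in>splits as. counit (M_basis vs) *\<^sub>Q M_basis us)"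
      by (simp add: linear_comult_M[OF tensor_lift_linear[OF R] as] tensor_lift_pure[OF R])
    also have "\<dots> = (\<Sum>(us, vs)\<in>splits as. if vs = [] then M_basis us else 0)"
    proof (intro sum.cong refl, clarify)
      fix us vs assume uv: "(us, vs) \<in> splits as"
      hence "vs \<in> compositions" using splits_compositions as by blast
      thus "counit (M_basis vs) *\<^sub>Q M_basis us = (if vs = [] then M_basis us else 0)"
        using uv by (auto simp: counit_M scaleQ_one splits_def)
    qed
    also have "\<dots> = M_basis as" by (rule sum_splits_Nil_right)
    finally show "tensor_lift (\<lambda>a b. counit b *\<^sub>Q a) (comult (M_basis as)) = M_basis as" .
  qed (rule qlinearI; simp)
qed (rule comult_linear counit_linear)+

section \<open>Quasi-shuffles and the bialgebra structure\<close>

abbreviation nonzeros :: "'e::zero list \<Rightarrow> 'e list" where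
  "nonzeros \<equiv> filter (\<lambda>e. e \<noteq> 0)"

abbreviation add_pairs :: "('e::plus \<times> 'e) list \<Rightarrow> 'e list" where
  "add_pairs \<equiv> map (\<lambda>(x, y). x + y)"

text \<open>
  A quasi-shuffle is a list of pairs, none of them \<open>(0, 0)\<close>, whose first components spell \<open>as\<close> and
  whose second components spell \<open>bs\<close> once zeros are deleted. Pairs with a zero component come from
  one of the lists only; the others merge an entry of \<open>as\<close> with an entry of \<open>bs\<close>. Keeping the pairs,
  rather than their sums, records multiplicities.
\<close>

definition quasi_shuffles :: "'e::zero list \<Rightarrow> 'e list \<Rightarrow> ('e \<times> 'e) list set" where
  "quasi_shuffles as bs =
     {zs. (0, 0) \<notin> set zs \<and> nonzeros (map fst zs) = as \<and> nonzeros (map snd zs) = bs}"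

lemma length_quasi_shuffle_le:
  "(0, 0) \<notin> set zs \<Longrightarrow>
    length zs \<le> length (nonzeros (map fst zs)) + length (nonzeros (map snd zs))"
  by (induction zs) auto

lemma finite_quasi_shuffles: "finite (quasi_shuffles as bs)"
proof (rule finite_subset)
  let ?E = "insert 0 (set as) \<times> insert 0 (set bs)"
  show "finite {zs. set zs \<subseteq> ?E \<and> length zs \<le> length as + length bs}"
    by (rule finite_lists_length_le) simp
  show "quasi_shuffles as bs \<subseteq> {zs. set zs \<subseteq> ?E \<and> length zs \<le> length as + length bs}"
    using length_quasi_shuffle_le by (force simp: quasi_shuffles_def)
qed

lemma add_pairs_compositions:
  fixes as bs :: "'e::exponent list"
  shows "zs \<in> quasi_shuffles as bs \<Longrightarrow> add_pairs zs \<in> compositions"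
  by (auto simp: quasi_shuffles_def compositions_def add_eq_zero_iff)

lemma sum_list_add_pairs:
  fixes as bs :: "'e::exponent list"
  assumes "zs \<in> quasi_shuffles as bs"
  shows "sum_list (add_pairs zs) = sum_list as + sum_list bs"
proof -
  have nz: "sum_list (nonzeros xs) = sum_list xs" for xs :: "'e list" by (induction xs) auto
  have "sum_list (add_pairs zs) = sum_list (map fst zs) + sum_list (map snd zs)"
    by (induction zs) (auto simp: algebra_simps)
  thus ?thesis using assms by (auto simp: quasi_shuffles_def nz)
qed

lemma finite_list_decomps: "finite (list_decomps (as :: 'e::exponent list))"
proof (induction as)
  case Nil
  have "list_decomps ([] :: 'e list) = {([], [])}" by (auto simp: list_decomps_def)
  thus ?case by simp
next
  case (Cons c as)
  have "list_decomps (c # as) \<subseteq> (\<lambda>((a, b), (u, v)). (a # u, b # v)) `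
      ({(a, b). a + b = c} \<times> list_decomps as)"
    by (force simp: list_decomps_def length_Suc_conv image_iff)
  thus ?case
    by (rule finite_subset) (intro finite_imageI finite_cartesian_product finite_decompositions Cons)
qed

lemma coeff_sum: "coeff (series_of (\<Sum>a\<in>A. f a)) m = (\<Sum>a\<in>A. coeff (series_of (f a)) m)"
  by (induction A rule: infinite_finite_induct)
     (auto simp: zero_quasisym.rep_eq plus_quasisym.rep_eq zero_series.rep_eq plus_series.rep_eq)

text \<open>
  The coefficient of \<open>m\<close> in the product counts the ways to write the exponent list of \<open>m\<close> as a
  position-wise sum of two lists that spell \<open>as\<close> and \<open>bs\<close> up to zeros. Zipping such lists gives
  the quasi-shuffles with sums \<open>packed m\<close>, as \<open>packed m\<close> has no zero entry.
\<close>

lemma M_basis_mult: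
  fixes as bs :: "'e::exponent list"
  assumes "as \<in> compositions" "bs \<in> compositions"
  shows "M_basis as * M_basis bs = (\<Sum>zs\<in>quasi_shuffles as bs. M_basis (add_pairs zs))"
proof -
  define F where "F = (\<lambda>x y. if x = as \<and> y = bs then 1 else 0 :: rat)"
  have "series_of (M_basis as * M_basis bs) =
      series_of (\<Sum>zs\<in>quasi_shuffles as bs. M_basis (add_pairs zs))"
  proof (rule series_eqI)
    fix m :: "nat \<Rightarrow>\<^sub>0 'e"
    let ?w = "packed m"
    let ?L = "{x\<in>list_decomps ?w. nonzeros (fst x) = as \<and> nonzeros (snd x) = bs}"
    let ?Z = "{zs\<in>quasi_shuffles as bs. ?w = add_pairs zs}"
    have w: "0 \<notin> set ?w" using packed_composition[of m] by (simp add: compositions_def)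
    have "coeff (series_of (M_basis as * M_basis bs)) m =
        (\<Sum>(p, q)\<in>{(p, q). p + q = m}. F (packed p) (packed q))"
      using assms
      by (auto simp: times_quasisym.rep_eq times_series.rep_eq coeff_M F_def intro!: sum.cong)
    also have "\<dots> = (\<Sum>(u, v)\<in>list_decomps ?w. F (nonzeros u) (nonzeros v))"
      by (rule sum_decompositions)
    also have "\<dots> = (\<Sum>x\<in>?L. 1)"
      by (subst sum.inter_filter[OF finite_list_decomps]) (auto simp: F_def intro!: sum.cong)
    also have "\<dots> = (\<Sum>zs\<in>?Z. 1)"
    proof (rule sum.reindex_bij_witness[where i = "\<lambda>zs. (map fst zs, map snd zs)"
          and j = "\<lambda>(u, v). zip u v"])
      fix x assume "x \<in> ?L"
      then obtain u v where x: "x = (u, v)" and len: "length u = length v"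
        and uv: "map2 (+) u v = ?w" "nonzeros u = as" "nonzeros v = bs"
        unfolding list_decomps_def by fastforce
      have "(0, 0) \<notin> set (zip u v)"
        using w unfolding uv(1)[symmetric] by force
      thus "(case x of (u, v) \<Rightarrow> zip u v) \<in> ?Z"
        using len uv by (simp add: x quasi_shuffles_def)
      show "(map fst (case x of (u, v) \<Rightarrow> zip u v), map snd (case x of (u, v) \<Rightarrow> zip u v)) = x"
        using len by (simp add: x)
    next
      fix zs assume "zs \<in> ?Z"
      thus "(map fst zs, map snd zs) \<in> ?L"
        by (auto simp: list_decomps_def quasi_shuffles_def zip_map_fst_snd)
      show "(case (map fst zs, map snd zs) of (u, v) \<Rightarrow> zip u v) = zs"
        by (simp add: zip_map_fst_snd)
    qed simp
    also have "\<dots> = (\<Sum>zs\<in>quasi_shuffles as bs. if ?w = add_pairs zs then 1 else 0)"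
      by (subst sum.inter_filter[OF finite_quasi_shuffles]) simp
    also have "\<dots> = coeff (series_of (\<Sum>zs\<in>quasi_shuffles as bs. M_basis (add_pairs zs))) m"
      unfolding coeff_sum by (intro sum.cong) (simp_all add: coeff_M[OF add_pairs_compositions])
    finally show "coeff (series_of (M_basis as * M_basis bs)) m =
        coeff (series_of (\<Sum>zs\<in>quasi_shuffles as bs. M_basis (add_pairs zs))) m" .
  qed
  thus ?thesis by (simp add: series_of_inject)
qed

text \<open>
  A cut of a quasi-shuffle determines cuts of the two lists, namely into what the two parts spell,
  and conversely quasi-shuffles of the left parts and of the right parts can be concatenated.
\<close>

lemma sum_splits_quasi_shuffles:
  fixes as bs :: "'e::zero list"
  shows "(\<Sum>zs\<in>quasi_shuffles as bs. \<Sum>(xs, ys)\<in>splits zs. F xs ys) =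
    (\<Sum>(us, us')\<in>splits as. \<Sum>(vs, vs')\<in>splits bs.
      \<Sum>xs\<in>quasi_shuffles us vs. \<Sum>ys\<in>quasi_shuffles us' vs'. F xs ys)"
proof -
  let ?B = "splits as \<times> splits bs"
  let ?Q = "\<lambda>((us, us'), (vs, vs')). quasi_shuffles us vs \<times> quasi_shuffles us' vs'"
  have "(\<Sum>zs\<in>quasi_shuffles as bs. \<Sum>(xs, ys)\<in>splits zs. F xs ys) =
      (\<Sum>(zs, xs, ys)\<in>Sigma (quasi_shuffles as bs) splits. F xs ys)"
    by (subst sum.Sigma) (auto simp: finite_splits finite_quasi_shuffles)
  also have "\<dots> = (\<Sum>(r, xs, ys)\<in>Sigma ?B ?Q. F xs ys)"
    by (rule sum.reindex_bij_witness[where i = "\<lambda>(r, xs, ys). (xs @ ys, xs, ys)"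
        and j = "\<lambda>(zs, xs, ys). (((nonzeros (map fst xs), nonzeros (map fst ys)),
          (nonzeros (map snd xs), nonzeros (map snd ys))), xs, ys)"])
       (auto simp: splits_def quasi_shuffles_def)
  also have "\<dots> = (\<Sum>r\<in>?B. \<Sum>(xs, ys)\<in>?Q r. F xs ys)"
    by (subst sum.Sigma) (auto simp: finite_splits finite_quasi_shuffles)
  also have "\<dots> = (\<Sum>(us, us')\<in>splits as. \<Sum>(vs, vs')\<in>splits bs.
      \<Sum>xs\<in>quasi_shuffles us vs. \<Sum>ys\<in>quasi_shuffles us' vs'. F xs ys)"
    by (simp add: sum.cartesian_product split_beta)
  finally show ?thesis .
qed

lemma quasisym_comult_mult:
  fixes x y :: "'e::exponent quasisym"
  shows "comult (x * y) = tensor_mult (*) (*) (comult x) (comult y)"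
proof (rule quasisym_bilinear_eqI[where f = "\<lambda>x y. comult (x * y)"])
  note tm = tensor_mult_bilinear[OF quasisym_mult_bilinear quasisym_mult_bilinear]
    and tmp = tensor_mult_pure[OF quasisym_mult_bilinear quasisym_mult_bilinear]
  have tm_left: "qlinear (\<lambda>s. tensor_mult (*) (*) s t)"
    and tm_right: "qlinear (\<lambda>t. tensor_mult (*) (*) s t)" for s t :: "'e quasisym \<otimes> 'e quasisym"
    using tm by (auto simp: qbilinear_def)
  fix x y :: "'e quasisym"
  show "qlinear (\<lambda>y. comult (x * y))"
    by (rule qlinear_compose[OF quasisym_mult_linear_right comult_linear])
  show "qlinear (\<lambda>x. comult (x * y))"
    by (rule qlinear_compose[OF quasisym_mult_linear_left comult_linear])
  show "qlinear (\<lambda>y. tensor_mult (*) (*) (comult x) (comult y))"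
    by (rule qlinear_compose[OF comult_linear tm_right])
  show "qlinear (\<lambda>x. tensor_mult (*) (*) (comult x) (comult y))"
    by (rule qlinear_compose[OF comult_linear tm_left])
  fix as bs :: "'e list" assume as: "as \<in> compositions" and bs: "bs \<in> compositions"
  have "comult (M_basis as * M_basis bs) =
      (\<Sum>zs\<in>quasi_shuffles as bs. comult (M_basis (add_pairs zs)))"
    by (simp add: M_basis_mult as bs qlinear_sum[OF comult_linear])
  also have "\<dots> = (\<Sum>zs\<in>quasi_shuffles as bs. \<Sum>(xs, ys)\<in>splits zs.
      M_basis (add_pairs xs) \<otimes>\<^sub>p M_basis (add_pairs ys))"
    by (intro sum.cong refl) (simp add: comult_splits add_pairs_compositions sum_splits_map)
  also have "\<dots> = (\<Sum>(us, us')\<in>splits as. \<Sum>(vs, vs')\<in>splits bs.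
      \<Sum>xs\<in>quasi_shuffles us vs. \<Sum>ys\<in>quasi_shuffles us' vs'.
        M_basis (add_pairs xs) \<otimes>\<^sub>p M_basis (add_pairs ys))"
    by (rule sum_splits_quasi_shuffles)
  also have "\<dots> = (\<Sum>(us, us')\<in>splits as. \<Sum>(vs, vs')\<in>splits bs.
      (M_basis us * M_basis vs) \<otimes>\<^sub>p (M_basis us' * M_basis vs'))"
  proof (intro sum.cong refl, clarify, intro sum.cong refl, clarify)
    fix us us' vs vs' assume "(us, us') \<in> splits as" "(vs, vs') \<in> splits bs"
    hence "us \<in> compositions" "us' \<in> compositions" "vs \<in> compositions" "vs' \<in> compositions"
      using splits_compositions as bs by blast+
    thus "(\<Sum>xs\<in>quasi_shuffles us vs. \<Sum>ys\<in>quasi_shuffles us' vs'.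
        M_basis (add_pairs xs) \<otimes>\<^sub>p M_basis (add_pairs ys)) =
        (M_basis us * M_basis vs) \<otimes>\<^sub>p (M_basis us' * M_basis vs')"
      by (simp add: M_basis_mult qlinear_sum[OF pure_tensor_linear_left]
          qlinear_sum[OF pure_tensor_linear_right]) (rule sum.swap)
  qed
  also have "\<dots> = tensor_mult (*) (*) (comult (M_basis as)) (comult (M_basis bs))"
    by (simp add: comult_splits as bs qlinear_sum[OF tm_left] qlinear_sum[OF tm_right] tmp
        split_beta) (rule sum.swap)
  finally show "comult (M_basis as * M_basis bs) =
      tensor_mult (*) (*) (comult (M_basis as)) (comult (M_basis bs))" .
qed

lemma counit_mult:
  fixes x y :: "'e::exponent quasisym"
  shows "counit (x * y) = counit x * counit y"
proof (rule quasisym_bilinear_eqI[where f = "\<lambda>x y. counit (x * y)"])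
  fix x y :: "'e quasisym"
  show "qlinear (\<lambda>y. counit (x * y))"
    by (rule qlinear_compose[OF quasisym_mult_linear_right counit_linear])
  show "qlinear (\<lambda>x. counit (x * y))"
    by (rule qlinear_compose[OF quasisym_mult_linear_left counit_linear])
  show "qlinear (\<lambda>y. counit x * counit y)" "qlinear (\<lambda>x. counit x * counit y)"
    by (rule qlinearI; simp add: qlinear_add[OF counit_linear] qlinear_scale[OF counit_linear]
        scaleQ_rat_def algebra_simps)+
  fix as bs :: "'e list" assume as: "as \<in> compositions" and bs: "bs \<in> compositions"
  have "counit (M_basis as * M_basis bs) =
      (\<Sum>zs\<in>quasi_shuffles as bs. if zs = [] then 1 else 0)"
    by (auto simp: M_basis_mult as bs qlinear_sum[OF counit_linear] counit_M
        add_pairs_compositions intro!: sum.cong)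
  also have "\<dots> = (if [] \<in> quasi_shuffles as bs then 1 else 0)"
    by (simp add: finite_quasi_shuffles)
  also have "\<dots> = counit (M_basis as) * counit (M_basis bs)"
    by (auto simp: counit_M as bs quasi_shuffles_def)
  finally show "counit (M_basis as * M_basis bs) = counit (M_basis as) * counit (M_basis bs)" .
qed

lemma Nil_compositions: "[] \<in> compositions"
  by (simp add: compositions_def)

lemma quasisym_bialgebra:
  "rat_bialgebra ((*) :: 'e::exponent quasisym \<Rightarrow> _) 1 comult counit"
proof -
  interpret rat_coalgebra comult "counit :: 'e quasisym \<Rightarrow> rat" by (rule quasisym_coalgebra)
  have "rat_algebra ((*) :: 'e quasisym \<Rightarrow> _) 1"
    by (simp add: rat_algebra_def quasisym_mult_bilinear mult.assoc)
  thus ?thesis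
  proof (intro rat_bialgebra.intro rat_bialgebra_axioms.intro rat_coalgebra_axioms)
    show "comult (1 :: 'e quasisym) = 1 \<otimes>\<^sub>p 1"
      using comult_splits[OF Nil_compositions, where 'a = 'e]
      by (simp add: splits_def M_basis_Nil)
    show "counit (1 :: 'e quasisym) = 1"
      using counit_M[OF Nil_compositions, where 'a = 'e] by (simp add: M_basis_Nil)
  qed (simp_all add: quasisym_comult_mult counit_mult)
qed

section \<open>The antipode\<close>

text \<open>
  The convolution product of functions on lists with respect to deconcatenation, and its unit. For
  linear maps on \<open>'e quasisym\<close>, restricted to the basis, it is the convolution product that
  defines antipodes.
\<close>

definition conv :: "('a list \<Rightarrow> 'b::ring_1) \<Rightarrow> ('a list \<Rightarrow> 'b) \<Rightarrow> 'a list \<Rightarrow> 'b" where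
  "conv f g ws = (\<Sum>(us, vs)\<in>splits ws. f us * g vs)"

definition conv_unit :: "'a list \<Rightarrow> 'b::ring_1" where
  "conv_unit ws = (if ws = [] then 1 else 0)"

lemma conv_assoc: "conv (conv f g) h = conv f (conv g h)"
proof
  fix ws
  have "conv (conv f g) h ws = (\<Sum>(us, cs)\<in>splits ws. \<Sum>(as, bs)\<in>splits us. f as * g bs * h cs)"
    by (simp add: conv_def sum_distrib_right split_beta)
  also have "\<dots> = (\<Sum>(as, us)\<in>splits ws. \<Sum>(bs, cs)\<in>splits us. f as * g bs * h cs)"
    by (rule sum_splits_assoc)
  also have "\<dots> = conv f (conv g h) ws"
    by (simp add: conv_def sum_distrib_left split_beta mult.assoc)
  finally show "conv (conv f g) h ws = conv f (conv g h) ws" .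
qed

lemma conv_unit_left: "conv conv_unit f = f"
proof
  fix ws
  have "conv conv_unit f ws = (\<Sum>(us, vs)\<in>splits ws. if us = [] then f vs else 0)"
    unfolding conv_def by (intro sum.cong) (auto simp: conv_unit_def)
  thus "conv conv_unit f ws = f ws" by (simp only: sum_splits_Nil_left)
qed

lemma conv_unit_right: "conv f conv_unit = f"
proof
  fix ws
  have "conv f conv_unit ws = (\<Sum>(us, vs)\<in>splits ws. if vs = [] then f us else 0)"
    unfolding conv_def by (intro sum.cong) (auto simp: conv_unit_def)
  thus "conv f conv_unit ws = f ws" by (simp only: sum_splits_Nil_right)
qed

text \<open>
  The left convolution inverse of an \<open>f\<close> with \<open>f [] = 1\<close>: the equation \<open>conv g f ws = 0\<close> for
  \<open>ws \<noteq> []\<close> is solved for the summand \<open>g ws * f []\<close>.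
\<close>

function conv_inv :: "('a list \<Rightarrow> 'b::ring_1) \<Rightarrow> 'a list \<Rightarrow> 'b" where
  "conv_inv f ws = (if ws = [] then 1
     else - (\<Sum>i<length ws. conv_inv f (take i ws) * f (drop i ws)))"
  by auto
termination by (relation "measure (\<lambda>(f, ws). length ws)") auto

declare conv_inv.simps [simp del]

lemma conv_inv_left: "f [] = 1 \<Longrightarrow> conv (conv_inv f) f = conv_unit"
  unfolding conv_def sum_splits fun_eq_iff conv_unit_def
  by (subst conv_inv.simps) (auto simp: conv_inv.simps[of f "[]"])

lemma conv_inv_right:
  assumes "f [] = 1" shows "conv f (conv_inv f) = conv_unit"
proof -
  \<comment> \<open>The left inverse \<open>?h\<close> of the left inverse \<open>?g\<close> of \<open>f\<close> is \<open>f\<close> itself.\<close>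
  let ?g = "conv_inv f" let ?h = "conv_inv ?g"
  have "?g [] = 1" by (simp add: conv_inv.simps)
  hence hg: "conv ?h ?g = conv_unit" by (rule conv_inv_left)
  have "?h = conv ?h (conv ?g f)" by (simp add: conv_inv_left assms conv_unit_right)
  also have "\<dots> = f" by (simp add: conv_assoc[symmetric] hg conv_unit_left)
  finally show ?thesis using hg by simp
qed

lemma is_antipode_quasisym_iff:
  fixes S :: "'e::exponent quasisym \<Rightarrow> 'e quasisym"
  shows "is_antipode (*) 1 comult counit S \<longleftrightarrow> qlinear S \<and>
    (\<forall>as\<in>compositions. conv (\<lambda>us. S (M_basis us)) M_basis as = conv_unit as \<and>
      conv M_basis (\<lambda>us. S (M_basis us)) as = conv_unit as)"
proof (cases "qlinear S")
  case True
  note lift = tensor_lift_linear[OF quasisym_mult_bilinear]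
    and lift_pure = tensor_lift_pure[OF quasisym_mult_bilinear]
  have l: "qlinear (\<lambda>t. tensor_lift (*) (tensor_map S id t))"
    and r: "qlinear (\<lambda>t. tensor_lift (*) (tensor_map id S t))"
    by (rule qlinear_compose[OF _ lift], rule tensor_map_linear; simp add: True qlinear_id)+
  have u: "qlinear (\<lambda>x :: 'e quasisym. counit x *\<^sub>Q (1 :: 'e quasisym))"
    using counit_bilinear(1) by (auto simp: qbilinear_def)
  have cl: "tensor_lift (*) (tensor_map S id (comult (M_basis as))) =
      conv (\<lambda>us. S (M_basis us)) M_basis as"
    and cr: "tensor_lift (*) (tensor_map id S (comult (M_basis as))) =
      conv M_basis (\<lambda>us. S (M_basis us)) as"
    and cu: "counit (M_basis as) *\<^sub>Q (1 :: 'e quasisym) = conv_unit as"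
    if "as \<in> compositions" for as
    using that
    by (simp_all add: linear_comult_M[OF l] linear_comult_M[OF r] tensor_map_pure True qlinear_id
        lift_pure conv_def counit_M conv_unit_def scaleQ_one)
  have "(\<forall>x. tensor_lift (*) (tensor_map S id (comult x)) = counit x *\<^sub>Q 1) \<longleftrightarrow>
      (\<forall>as\<in>compositions. conv (\<lambda>us. S (M_basis us)) M_basis as = conv_unit as)"
    using quasisym_eqI[OF qlinear_compose[OF comult_linear l] u] cl cu by metis
  moreover have "(\<forall>x. tensor_lift (*) (tensor_map id S (comult x)) = counit x *\<^sub>Q 1) \<longleftrightarrow>
      (\<forall>as\<in>compositions. conv M_basis (\<lambda>us. S (M_basis us)) as = conv_unit as)"
    using quasisym_eqI[OF qlinear_compose[OF comult_linear r] u] cr cu by metis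
  ultimately show ?thesis unfolding is_antipode_def by blast
qed (simp add: is_antipode_def)

lemma quasisym_antipode_exists:
  "\<exists>S. is_antipode ((*) :: 'e::exponent quasisym \<Rightarrow> _) 1 comult counit S"
proof
  let ?f = "conv_inv (M_basis :: 'e list \<Rightarrow> 'e quasisym)"
  have "conv (\<lambda>us. basis_extend ?f (M_basis us)) M_basis as = conv ?f M_basis as"
    and "conv M_basis (\<lambda>us. basis_extend ?f (M_basis us)) as = conv M_basis ?f as"
    if "as \<in> compositions" for as :: "'e list"
    unfolding conv_def using splits_compositions[OF that]
    by (auto simp: basis_extend_M intro!: sum.cong)
  thus "is_antipode ((*) :: 'e quasisym \<Rightarrow> _) 1 comult counit (basis_extend ?f)"
    by (simp add: is_antipode_quasisym_iff basis_extend_linear conv_inv_left conv_inv_right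
        M_basis_Nil)
qed

text \<open>
  The left antipode equation alone determines an antipode, recursively in the length of \<open>as\<close>.
\<close>

lemma antipode_M_basis:
  fixes as :: "'e::exponent list"
  assumes S: "is_antipode (*) 1 comult counit S" and as: "as \<in> compositions"
  shows "S (M_basis as) = (if as = [] then 1
    else - (\<Sum>i<length as. S (M_basis (take i as)) * M_basis (drop i as)))"
proof -
  have "conv (\<lambda>us. S (M_basis us)) M_basis as = conv_unit as"
    using S as unfolding is_antipode_quasisym_iff by blast
  thus ?thesis
    unfolding conv_def sum_splits conv_unit_def by (auto simp: M_basis_Nil eq_neg_iff_add_eq_0)
qed

section \<open>Gradings\<close>

text \<open>
  The span of the basis elements of degree \<open>d\<close>, where \<open>as\<close> has degree \<open>\<phi> (sum_list as)\<close>. The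
  identity gives the degree or bidegree, and \<open>\<phi> (a, b) = a + b\<close> gives the total degree.
\<close>

definition graded_part :: "('e::exponent \<Rightarrow> 'g) \<Rightarrow> 'g \<Rightarrow> 'e quasisym set" where
  "graded_part \<phi> d = Q.span {M_basis as | as. as \<in> compositions \<and> \<phi> (sum_list as) = d}"

lemma graded_part_subspace: "Q.subspace (graded_part \<phi> d)"
  unfolding graded_part_def by (rule Q.subspace_span)

lemma M_basis_graded:
  "as \<in> compositions \<Longrightarrow> \<phi> (sum_list as) = d \<Longrightarrow> M_basis as \<in> graded_part \<phi> d"
  unfolding graded_part_def by (rule Q.span_base) blast

lemma qlinear_graded_part:
  assumes "qlinear f" "Q.subspace T" "x \<in> graded_part \<phi> d"
    and "\<And>as. as \<in> compositions \<Longrightarrow> \<phi> (sum_list as) = d \<Longrightarrow> f (M_basis as) \<in> T"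
  shows "f x \<in> T"
  using assms(3) unfolding graded_part_def
proof (induction rule: Q.span_induct_alt)
  case base
  show ?case by (simp add: qlinear_zero[OF assms(1)] Q.subspace_0[OF assms(2)])
next
  case (step c x y)
  thus ?case
    by (auto simp: qlinear_add[OF assms(1)] qlinear_scale[OF assms(1)]
        intro!: Q.subspace_add[OF assms(2)] Q.subspace_scale[OF assms(2)] assms(4))
qed

lemma coeff_graded_part:
  assumes "x \<in> graded_part \<phi> d" "\<phi> (sum_list (packed m)) \<noteq> d"
  shows "coeff (series_of x) m = 0"
proof -
  have "coeff (series_of x) m \<in> {0}"
  proof (rule qlinear_graded_part[OF _ _ assms(1), where f = "\<lambda>x. coeff (series_of x) m"])
    show "qlinear (\<lambda>x. coeff (series_of x) m)"
      by (rule qlinearI)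
         (simp_all add: plus_quasisym.rep_eq plus_series.rep_eq scaleQ_quasisym.rep_eq
            scaleQ_series.rep_eq scaleQ_rat_def)
  qed (use assms(2) in \<open>auto simp: coeff_M Q.subspace_single_0\<close>)
  thus ?thesis by simp
qed

lemma sum_keys_add:
  fixes c d :: "'g \<Rightarrow>\<^sub>0 'b::comm_monoid_add"
  shows "(\<Sum>g\<in>Poly_Mapping.keys (c + d). Poly_Mapping.lookup (c + d) g) =
    (\<Sum>g\<in>Poly_Mapping.keys c. Poly_Mapping.lookup c g) +
    (\<Sum>g\<in>Poly_Mapping.keys d. Poly_Mapping.lookup d g)"
  by (rule setsum_keys_plus_distrib) auto

text \<open>
  The decomposition is unique because it can be read off the coefficients: the component of degree
  \<open>g\<close> has at \<open>m\<close> the same coefficient as \<open>x\<close> if \<open>\<phi> (sum_list (packed m)) = g\<close>, and \<open>0\<close> otherwise.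
\<close>

lemma is_grading_graded_part:
  fixes \<phi> :: "'e::exponent \<Rightarrow> 'g"
  shows "is_grading (graded_part \<phi>)"
  unfolding is_grading_def
proof (intro conjI allI)
  show "Q.subspace (graded_part \<phi> g)" for g by (rule graded_part_subspace)
  fix x :: "'e quasisym"
  let ?H = "\<lambda>c. \<Sum>g\<in>Poly_Mapping.keys c. Poly_Mapping.lookup c g"
  let ?P = "\<lambda>c. (\<forall>g. Poly_Mapping.lookup c g \<in> graded_part \<phi> g) \<and> x = ?H c"
  show "\<exists>!c :: 'g \<Rightarrow>\<^sub>0 'e quasisym. ?P c"
  proof (rule ex_ex1I)
    have "x \<in> Q.span (M_basis ` compositions)" unfolding span_M by (rule UNIV_I)
    thus "\<exists>c. ?P c"
    proof (induction rule: Q.span_induct_alt)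
      case base
      show ?case by (intro exI[of _ 0]) (simp add: Q.subspace_0[OF graded_part_subspace])
    next
      case (step k x y)
      then obtain as c where as: "as \<in> compositions" "x = M_basis as"
        and c: "\<And>g. Poly_Mapping.lookup c g \<in> graded_part \<phi> g" "y = ?H c"
        by blast
      let ?d = "Poly_Mapping.single (\<phi> (sum_list as)) (k *\<^sub>Q x)"
      have "Poly_Mapping.lookup ?d g \<in> graded_part \<phi> g" for g
        using as M_basis_graded[OF as(1), of \<phi> g]
        by (auto simp: lookup_single when_def Q.subspace_0[OF graded_part_subspace]
            intro!: Q.subspace_scale[OF graded_part_subspace])
      hence "Poly_Mapping.lookup (?d + c) g \<in> graded_part \<phi> g" for g
        using c(1) by (simp add: lookup_add Q.subspace_add[OF graded_part_subspace])
      moreover have "k *\<^sub>Q x + y = ?H (?d + c)"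
        unfolding sum_keys_add c(2) by simp
      ultimately show ?case by blast
    qed
  next
    fix c d :: "'g \<Rightarrow>\<^sub>0 'e quasisym"
    assume c: "?P c" and d: "?P d"
    have co: "coeff (series_of (Poly_Mapping.lookup c g)) m =
        (if \<phi> (sum_list (packed m)) = g then coeff (series_of x) m else 0)"
      if c: "?P c" for c :: "'g \<Rightarrow>\<^sub>0 'e quasisym" and g m
    proof -
      let ?g = "\<phi> (sum_list (packed m))"
      have 0: "coeff (series_of (Poly_Mapping.lookup c h)) m = 0" if "h \<noteq> ?g" for h
        using coeff_graded_part[of "Poly_Mapping.lookup c h" \<phi> h m] c that by metis
      have "coeff (series_of x) m =
          (\<Sum>h\<in>Poly_Mapping.keys c. coeff (series_of (Poly_Mapping.lookup c h)) m)"
        using c by (metis coeff_sum)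
      also have "\<dots> = (\<Sum>h\<in>Poly_Mapping.keys c.
          if h = ?g then coeff (series_of (Poly_Mapping.lookup c ?g)) m else 0)"
        by (rule sum.cong) (auto simp: 0)
      also have "\<dots> = coeff (series_of (Poly_Mapping.lookup c ?g)) m"
        by (auto simp: in_keys_iff zero_quasisym.rep_eq zero_series.rep_eq)
      finally show ?thesis using 0[of g] by auto
    qed
    show "c = d"
    proof (rule poly_mapping_eqI)
      fix g
      have "series_of (Poly_Mapping.lookup c g) = series_of (Poly_Mapping.lookup d g)"
        by (rule series_eqI) (simp only: co[OF c] co[OF d])
      thus "Poly_Mapping.lookup c g = Poly_Mapping.lookup d g" by (simp add: series_of_inject)
    qed
  qed
qed

lemma sum_list_splits:
  "(us, vs) \<in> splits as \<Longrightarrow> sum_list as = sum_list us + (sum_list vs :: 'e::exponent)"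
  by (auto simp: splits_def)

lemma graded_hopf_algebra_quasisym:
  fixes \<phi> :: "'e::exponent \<Rightarrow> 'g::comm_monoid_add"
  assumes \<phi>_0: "\<phi> 0 = 0" and \<phi>_add: "\<And>a b. \<phi> (a + b) = \<phi> a + \<phi> b"
  shows "graded_hopf_algebra ((*) :: 'e quasisym \<Rightarrow> _) 1 comult counit (graded_part \<phi>)"
proof -
  let ?V = "graded_part \<phi>"
  have mult: "x * y \<in> ?V (g + h)" if x: "x \<in> ?V g" and y: "y \<in> ?V h" for x y g h
  proof (rule qlinear_graded_part[OF quasisym_mult_linear_left graded_part_subspace x])
    fix as :: "'e list" assume as: "as \<in> compositions" "\<phi> (sum_list as) = g"
    show "M_basis as * y \<in> ?V (g + h)"
    proof (rule qlinear_graded_part[OF quasisym_mult_linear_right graded_part_subspace y])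
      fix bs :: "'e list" assume bs: "bs \<in> compositions" "\<phi> (sum_list bs) = h"
      show "M_basis as * M_basis bs \<in> ?V (g + h)"
        unfolding M_basis_mult[OF as(1) bs(1)]
      proof (rule Q.subspace_sum[OF graded_part_subspace])
        fix zs assume zs: "zs \<in> quasi_shuffles as bs"
        show "M_basis (add_pairs zs) \<in> ?V (g + h)"
          by (rule M_basis_graded[OF add_pairs_compositions[OF zs]])
             (simp add: sum_list_add_pairs[OF zs] \<phi>_add as(2) bs(2))
      qed
    qed
  qed
  have comult: "comult x \<in> Q.span {a \<otimes>\<^sub>p b | a b h k. h + k = g \<and> a \<in> ?V h \<and> b \<in> ?V k}"
    (is "_ \<in> ?T") if x: "x \<in> ?V g" for x g
  proof (rule qlinear_graded_part[OF comult_linear Q.subspace_span x])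
    fix as :: "'e list" assume as: "as \<in> compositions" "\<phi> (sum_list as) = g"
    have split: "M_basis us \<otimes>\<^sub>p M_basis vs \<in> ?T" if "(us, vs) \<in> splits as" for us vs
    proof -
      have "M_basis us \<in> ?V (\<phi> (sum_list us))" "M_basis vs \<in> ?V (\<phi> (sum_list vs))"
        using splits_compositions[OF as(1) that] by (simp_all add: M_basis_graded)
      moreover have "\<phi> (sum_list us) + \<phi> (sum_list vs) = g"
        using sum_list_splits[OF that] as(2) by (simp add: \<phi>_add)
      ultimately show ?thesis by (intro Q.span_base) blast
    qed
    show "comult (M_basis as) \<in> ?T"
      unfolding comult_splits[OF as(1)]
    proof (rule Q.span_sum)
      fix p assume "p \<in> splits as"
      thus "(case p of (us, vs) \<Rightarrow> M_basis us \<otimes>\<^sub>p M_basis vs) \<in> ?T"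
        by (cases p) (simp only: prod.case split)
    qed
  qed
  have counit: "counit x = 0" if x: "x \<in> ?V g" and g: "g \<noteq> 0" for x g
  proof -
    have "counit x \<in> {0}"
      by (rule qlinear_graded_part[OF counit_linear Q.subspace_single_0 x])
         (use g \<phi>_0 in \<open>auto simp: counit_M\<close>)
    thus ?thesis by simp
  qed
  have antipode: "S x \<in> ?V g"
    if S: "is_antipode (*) 1 comult counit S" and x: "x \<in> ?V g" for S x g
  proof -
    have gr: "S (M_basis as) \<in> ?V (\<phi> (sum_list as))" if "as \<in> compositions" for as
      using that
    proof (induction as rule: length_induct)
      case (1 as)
      have terms: "S (M_basis (take i as)) * M_basis (drop i as) \<in> ?V (\<phi> (sum_list as))"
        if i: "i < length as" for i
      proof -
        have sp: "(take i as, drop i as) \<in> splits as" by (simp add: splits_def)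
        note co = splits_compositions[OF 1(2) sp]
        have "S (M_basis (take i as)) \<in> ?V (\<phi> (sum_list (take i as)))"
          using 1(1) i co by simp
        hence "S (M_basis (take i as)) * M_basis (drop i as) \<in>
            ?V (\<phi> (sum_list (take i as)) + \<phi> (sum_list (drop i as)))"
          by (rule mult) (use co in \<open>simp add: M_basis_graded\<close>)
        thus ?thesis by (simp add: sum_list_splits[OF sp] \<phi>_add)
      qed
      have "- (\<Sum>i<length as. S (M_basis (take i as)) * M_basis (drop i as))
          \<in> ?V (\<phi> (sum_list as))"
        by (intro Q.subspace_neg[OF graded_part_subspace] Q.subspace_sum[OF graded_part_subspace])
           (simp add: terms)
      moreover have "(1 :: 'e quasisym) \<in> ?V (\<phi> (sum_list []))"
        unfolding M_basis_Nil[symmetric] by (rule M_basis_graded[OF Nil_compositions refl])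
      ultimately show ?case
        unfolding antipode_M_basis[OF S 1(2)] by (cases "as = []") simp_all
    qed
    have "qlinear S" using S by (simp add: is_antipode_def)
    thus ?thesis
      by (rule qlinear_graded_part[OF _ graded_part_subspace x]) (use gr in blast)
  qed
  have unit: "(1 :: 'e quasisym) \<in> ?V 0"
    unfolding M_basis_Nil[symmetric] by (rule M_basis_graded[OF Nil_compositions]) (simp add: \<phi>_0)
  show ?thesis
    by (intro graded_hopf_algebra.intro rat_hopf_algebra.intro quasisym_bialgebra
        rat_hopf_algebra_axioms.intro quasisym_antipode_exists graded_hopf_algebra_axioms.intro
        is_grading_graded_part unit)
       (rule mult comult counit antipode; assumption)+
qed

lemma degree_component_eq: "degree_component = graded_part (\<lambda>d. d)"
  by (simp add: fun_eq_iff degree_component_def graded_part_def)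

lemma total_degree_component_eq: "total_degree_component = graded_part (\<lambda>(a, b). a + b)"
proof
  fix n :: nat
  let ?S = "\<lambda>d. {M_basis as | as :: (nat \<times> nat) list. as \<in> compositions \<and> sum_list as = d}"
  let ?T = "{M_basis as | as. as \<in> compositions \<and> (\<lambda>(a, b). a + b) (sum_list as) = n}"
  have "degree_component (d1, d2) \<subseteq> Q.span ?T" if "d1 + d2 = n" for d1 d2
    unfolding degree_component_def using that by (intro Q.span_mono) auto
  hence "(\<Union>(d1, d2)\<in>{(d1, d2). d1 + d2 = n}. degree_component (d1, d2)) \<subseteq> Q.span ?T"
    by blast
  moreover have "?T \<subseteq> (\<Union>(d1, d2)\<in>{(d1, d2). d1 + d2 = n}. degree_component (d1, d2))"
  proof
    fix x assume "x \<in> ?T"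
    then obtain as where as: "x = M_basis as" "as \<in> compositions"
      "fst (sum_list as) + snd (sum_list as) = n" by (auto simp: split_beta)
    have "x \<in> degree_component (fst (sum_list as), snd (sum_list as))"
      using as by (simp add: degree_component_eq M_basis_graded)
    thus "x \<in> (\<Union>(d1, d2)\<in>{(d1, d2). d1 + d2 = n}. degree_component (d1, d2))"
      using as(3) by blast
  qed
  ultimately show "total_degree_component n = graded_part (\<lambda>(a, b). a + b) n"
    unfolding total_degree_component_def graded_part_def
    by (intro antisym Q.span_mono Q.span_minimal Q.subspace_span)
qed

section \<open>The projection to quasi-symmetric functions\<close>

lemma set_y_eq_x_monomial_add:
  "set_y_eq_x_monomial (p + q) = set_y_eq_x_monomial p + set_y_eq_x_monomial q"
  by (rule poly_mapping_eqI) (simp add: set_y_eq_x_monomial.rep_eq lookup_add)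

text \<open>
  Both sides sum \<open>coeff f p * coeff g q\<close> over all pairs of monomials whose product becomes \<open>c\<close>;
  on the left they are grouped by \<open>p + q\<close>, on the right by the images of \<open>p\<close> and \<open>q\<close>.
\<close>

lemma set_y_eq_x_series_mult:
  "set_y_eq_x_series (f * g) = set_y_eq_x_series f * set_y_eq_x_series g"
proof (rule series_eqI)
  fix c :: "nat \<Rightarrow>\<^sub>0 nat"
  let ?y = set_y_eq_x_monomial
  let ?F = "\<lambda>c. {m. ?y m = c}"
  let ?D = "\<lambda>m. {(p, q). p + q = m}"
  note fin = finite_set_y_eq_x_monomial finite_decompositions
  have "coeff (set_y_eq_x_series (f * g)) c =
      (\<Sum>m\<in>?F c. \<Sum>(p, q)\<in>?D m. coeff f p * coeff g q)"
    by (simp add: set_y_eq_x_series.rep_eq times_series.rep_eq)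
  also have "\<dots> = (\<Sum>(m, p, q)\<in>Sigma (?F c) ?D. coeff f p * coeff g q)"
    by (intro sum.Sigma fin ballI)
  also have "\<dots> = (\<Sum>(x, p, q)\<in>Sigma (?D c) (\<lambda>x. ?F (fst x) \<times> ?F (snd x)).
      coeff f p * coeff g q)"
    by (rule sum.reindex_bij_witness[where i = "\<lambda>(x, p, q). (p + q, p, q)"
          and j = "\<lambda>(m, p, q). ((?y p, ?y q), p, q)"]) (auto simp: set_y_eq_x_monomial_add)
  also have "\<dots> = (\<Sum>x\<in>?D c. \<Sum>(p, q)\<in>?F (fst x) \<times> ?F (snd x). coeff f p * coeff g q)"
    by (intro sum.Sigma[symmetric] fin ballI finite_cartesian_product)
  also have "\<dots> = coeff (set_y_eq_x_series f * set_y_eq_x_series g) c"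
    by (simp add: set_y_eq_x_series.rep_eq times_series.rep_eq sum_product sum.cartesian_product
        split_beta)
  finally show "coeff (set_y_eq_x_series (f * g)) c =
      coeff (set_y_eq_x_series f * set_y_eq_x_series g) c" .
qed

lemma set_y_eq_x_mult: "set_y_eq_x (f * g) = set_y_eq_x f * set_y_eq_x g"
  by transfer (rule set_y_eq_x_series_mult)

lemma set_y_eq_x_linear: "qlinear set_y_eq_x"
proof (rule qlinearI)
  show "set_y_eq_x (x + y) = set_y_eq_x x + set_y_eq_x y" for x y
    by transfer (rule qlinear_add[OF set_y_eq_x_series_linear])
  show "set_y_eq_x (c *\<^sub>Q x) = c *\<^sub>Q set_y_eq_x x" for c x
    by transfer (rule qlinear_scale[OF set_y_eq_x_series_linear])
qed

lemma set_y_eq_x_1: "set_y_eq_x 1 = 1"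
  using set_y_eq_x_M[OF Nil_compositions] by (simp add: M_basis_Nil)

lemma set_y_eq_x_comult: "comult (set_y_eq_x x) = tensor_map set_y_eq_x set_y_eq_x (comult x)"
proof (rule quasisym_eqI[where f = "\<lambda>x. comult (set_y_eq_x x)"])
  note tm = tensor_map_linear[OF set_y_eq_x_linear set_y_eq_x_linear]
  show "qlinear (\<lambda>x. comult (set_y_eq_x x))"
    by (rule qlinear_compose[OF set_y_eq_x_linear comult_linear])
  show "qlinear (\<lambda>x. tensor_map set_y_eq_x set_y_eq_x (comult x))"
    by (rule qlinear_compose[OF comult_linear tm])
  fix as :: "(nat \<times> nat) list" assume as: "as \<in> compositions"
  have "comult (set_y_eq_x (M_basis as)) =
      (\<Sum>(us, vs)\<in>splits as. M_basis (add_pairs us) \<otimes>\<^sub>p M_basis (add_pairs vs))"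
    by (simp add: set_y_eq_x_M as comult_splits map_plus_compositions sum_splits_map)
  also have "\<dots> = (\<Sum>(us, vs)\<in>splits as. set_y_eq_x (M_basis us) \<otimes>\<^sub>p set_y_eq_x (M_basis vs))"
    using splits_compositions[OF as] by (auto simp: set_y_eq_x_M intro!: sum.cong)
  also have "\<dots> = tensor_map set_y_eq_x set_y_eq_x (comult (M_basis as))"
    by (simp add: linear_comult_M[OF tm as] tensor_map_pure set_y_eq_x_linear)
  finally show "comult (set_y_eq_x (M_basis as)) =
      tensor_map set_y_eq_x set_y_eq_x (comult (M_basis as))" .
qed

lemma set_y_eq_x_counit: "counit (set_y_eq_x x) = counit x"
  by (rule quasisym_eqI[where f = "\<lambda>x. counit (set_y_eq_x x)"])
     (simp_all add: qlinear_compose[OF set_y_eq_x_linear counit_linear] counit_linear set_y_eq_x_M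
        counit_M map_plus_compositions)

text \<open>
  Both sides satisfy the recursion of \<open>antipode_M_basis\<close> for \<open>T\<close>.
\<close>

lemma set_y_eq_x_antipode:
  assumes S: "is_antipode (*) 1 comult counit S" and T: "is_antipode (*) 1 comult counit T"
  shows "set_y_eq_x (S x) = T (set_y_eq_x x)"
proof (rule quasisym_eqI[where f = "\<lambda>x. set_y_eq_x (S x)"])
  have "qlinear S" "qlinear T" using S T by (simp_all add: is_antipode_def)
  thus "qlinear (\<lambda>x. set_y_eq_x (S x))" "qlinear (\<lambda>x. T (set_y_eq_x x))"
    by (simp_all add: qlinear_compose set_y_eq_x_linear)
  fix as :: "(nat \<times> nat) list"
  assume "as \<in> compositions"
  thus "set_y_eq_x (S (M_basis as)) = T (set_y_eq_x (M_basis as))"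
  proof (induction as rule: length_induct)
    case (1 as)
    show ?case
    proof (cases "as = []")
      case True
      thus ?thesis
        using antipode_M_basis[OF S Nil_compositions] antipode_M_basis[OF T Nil_compositions]
        by (simp add: M_basis_Nil set_y_eq_x_1)
    next
      case False
      have "set_y_eq_x (S (M_basis (take i as)) * M_basis (drop i as)) =
          T (M_basis (take i (add_pairs as))) * M_basis (drop i (add_pairs as))"
        if i: "i < length as" for i
      proof -
        have "(take i as, drop i as) \<in> splits as" by (simp add: splits_def)
        note co = splits_compositions[OF 1(2) this]
        hence "set_y_eq_x (S (M_basis (take i as))) = T (set_y_eq_x (M_basis (take i as)))"
          using 1(1) i by simp
        thus ?thesis using co by (simp add: set_y_eq_x_mult set_y_eq_x_M take_map drop_map)
      qed
      hence "set_y_eq_x (- (\<Sum>i<length as. S (M_basis (take i as)) * M_basis (drop i as))) =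
          - (\<Sum>i<length as. T (M_basis (take i (add_pairs as))) * M_basis (drop i (add_pairs as)))"
        using qlinear_diff[OF set_y_eq_x_linear, of 0] qlinear_zero[OF set_y_eq_x_linear]
        by (simp add: qlinear_sum[OF set_y_eq_x_linear])
      thus ?thesis
        using False antipode_M_basis[OF S 1(2)]
          antipode_M_basis[OF T map_plus_compositions[OF 1(2)]]
        by (simp add: set_y_eq_x_M[OF 1(2)])
    qed
  qed
qed

lemma set_y_eq_x_graded:
  assumes "x \<in> total_degree_component n" shows "set_y_eq_x x \<in> degree_component n"
  unfolding degree_component_eq
proof (rule qlinear_graded_part[OF set_y_eq_x_linear graded_part_subspace
      assms[unfolded total_degree_component_eq]])
  fix as :: "(nat \<times> nat) list"
  assume as: "as \<in> compositions" "(case sum_list as of (a, b) \<Rightarrow> a + b) = n"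
  have "sum_list (add_pairs as) = fst (sum_list as) + snd (sum_list as)"
    by (induction as) auto
  thus "set_y_eq_x (M_basis as) \<in> graded_part (\<lambda>d. d) n"
    using as by (simp add: set_y_eq_x_M M_basis_graded map_plus_compositions split_beta)
qed

theorem theorem2p2:
  shows "graded_hopf_algebra ((*) :: dqsym \<Rightarrow> dqsym \<Rightarrow> dqsym) 1 comult counit
      (degree_component :: nat \<times> nat \<Rightarrow> dqsym set) \<and>
    graded_hopf_morphism
      ((*) :: dqsym \<Rightarrow> dqsym \<Rightarrow> dqsym) 1 comult counit total_degree_component
      ((*) :: qsym \<Rightarrow> qsym \<Rightarrow> qsym) 1 comult counit degree_component
      set_y_eq_x"
proof
  show "graded_hopf_algebra ((*) :: dqsym \<Rightarrow> dqsym \<Rightarrow> dqsym) 1 comult counit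
      (degree_component :: nat \<times> nat \<Rightarrow> dqsym set)"
    unfolding degree_component_eq by (rule graded_hopf_algebra_quasisym) simp_all
  have "graded_hopf_algebra ((*) :: dqsym \<Rightarrow> dqsym \<Rightarrow> dqsym) 1 comult counit
      total_degree_component"
    unfolding total_degree_component_eq
    by (rule graded_hopf_algebra_quasisym) (auto simp: zero_prod_def)
  moreover have "graded_hopf_algebra ((*) :: qsym \<Rightarrow> qsym \<Rightarrow> qsym) 1 comult counit
      degree_component"
    unfolding degree_component_eq by (rule graded_hopf_algebra_quasisym) simp_all
  ultimately show "graded_hopf_morphism
      ((*) :: dqsym \<Rightarrow> dqsym \<Rightarrow> dqsym) 1 comult counit total_degree_component
      ((*) :: qsym \<Rightarrow> qsym \<Rightarrow> qsym) 1 comult counit degree_component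
      set_y_eq_x"
    by (intro graded_hopf_morphism.intro graded_hopf_morphism_axioms.intro set_y_eq_x_linear
        set_y_eq_x_mult set_y_eq_x_1 set_y_eq_x_comult set_y_eq_x_counit set_y_eq_x_antipode
        set_y_eq_x_graded)
qed

end
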